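(* Let $K$ be a compact set in $\mathbb{C}\setminus(\Gamma_0\cup\Gamma_1\cup\Gamma_2)$. Then $$\lim_{n\to\infty}\frac{1}{n^{2/3}}\frac{P_{n,n}(n^{1/3}x)}{P_{n-1,n-1}(n^{1/3}x)}=\Phi(x)$$ holds uniformly for $x\in K$, where $$\Phi(x)=\frac{1}{e^{2\pi i/3}\left(\frac{-3+\sqrt{9-4x^3}}{2}\right)^{2/3}+e^{-2\pi i/3}\left(\frac{-3-\sqrt{9-4x^3}}{2}\right)^{2/3}+2x},$$ with the branches of the roots as specified in the context. Furthermore $$\lim_{n\to\infty}\frac{1}{n^{2/3}}\frac{P_{n,n}'(n^{1/3}x)}{P_{n,n}(n^{1/3}x)}=3x^2-3\Phi(x)$$ holds uniformly for $x\in K$.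
   Context: Let $\omega=e^{2\pi i/3}$ and, for $k=0,1,2$, let $\Gamma_k=\{r\omega^k: r\ge 0\}$ be the closed ray in $\mathbb{C}$ from the origin in direction $\omega^k$. All rays are oriented from left to right, so $\Gamma_0$ goes from $0$ to $+\infty$, while $\Gamma_1,\Gamma_2$ go from infinity to $0$. Thus for $j=1,2$ $$\int_{\Gamma_0\cup\Gamma_j} f(x)\,dx=\int_0^\infty f(t)\,dt-\omega^j\int_0^\infty f(\omega^j t)\,dt .$$ $P_{n,n}$ ($n=0,1,2,\ldots$) is the (unique) monic polynomial of degree $2n$ satisfying, for both $j=1$ and $j=2$, $$\int_{\Gamma_0\cup\Gamma_j}x^iP_{n,n}(x)e^{-x^3}dx=0,\qquad i=0,1,\ldots,n-1.$$ Branches in the formula for $\Phi$: in each of the three open sectors that make up $\mathbb{C}\setminus(\Gamma_0\cup\Gamma_1\cup\Gamma_2)$, $\sqrt{9-4x^3}$ is an analytic branch, and the two powers $(\cdot)^{2/3}$ are $A(x)^2$ and $B(x)^2$, where $A,B$ are analytic with $$A^3=\frac{-3+\sqrt{9-4x^3}}{2},\qquad B^3=\frac{-3-\sqrt{9-4x^3}}{2},\qquad A(x)B(x)=x,$$ chosen so that $\Phi(x)=x^2+\mathcal{O}(1/x)$ as $x\to\infty$. Equivalently, $\Phi$ is the solution of the cubic equation $\Phi(x)=\left(x-\frac{1}{3\Phi(x)}\right)^2$ that is analytic in $\mathbb{C}\setminus(\Gamma_0\cup\Gamma_1\cup\Gamma_2)$ and behaves as $\Phi(x)=x^2+\mathcal{O}(1/x)$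 as $x\to\infty$. *)

theory Defs
  imports "HOL-Analysis.Analysis" "HOL-Library.Landau_Symbols"
begin

definition omega :: complex where
  "omega = exp (2 * of_real pi * \<i> / 3)"

definition Gamma_ray :: "nat \<Rightarrow> complex set" where
  "Gamma_ray k = {of_real r * omega ^ k | r::real. r \<ge> 0}"

definition star_compl :: "complex set" where
  "star_compl = - (Gamma_ray 0 \<union> Gamma_ray 1 \<union> Gamma_ray 2)"

text \<open>The integral over the union of the rays 0 and j (for j = 1, 2), where ray 0 runs from the
  origin to infinity and ray j runs from infinity to the origin. Each ray is parametrised by its
  distance t to the origin.\<close>

definition contour_int :: "nat \<Rightarrow> (complex \<Rightarrow> complex) \<Rightarrow> complex" where
  "contour_int j f =
     (LBINT t:{0..}. f (of_real t)) - omega ^ j * (LBINT t:{0..}. f (omega ^ j * of_real t))"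

text \<open>The diagonal type II multiple orthogonal polynomial with multi-index (n,n).\<close>

definition is_diag_MOP :: "nat \<Rightarrow> complex poly \<Rightarrow> bool" where
  "is_diag_MOP n p \<longleftrightarrow>
     lead_coeff p = 1 \<and> degree p = 2 * n \<and>
     (\<forall>j\<in>{1, 2}. \<forall>i<n. contour_int j (\<lambda>x. x ^ i * poly p x * exp (- (x ^ 3))) = 0)"

text \<open>\<open>R\<close> is a branch of the square root; \<open>A\<^sup>2\<close> and \<open>B\<^sup>2\<close> below play the role of
  the powers with exponent 2/3. The set \<open>star_compl\<close> has three components (the open sectors), so
  analyticity on it leaves the choice of branches in different sectors independent.\<close>

definition cardano_branches ::
    "(complex \<Rightarrow> complex) \<Rightarrow> (complex \<Rightarrow> complex) \<Rightarrow> (complex \<Rightarrow> complex) \<Rightarrow> bool" where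
  "cardano_branches R A B \<longleftrightarrow>
     R analytic_on star_compl \<and> A analytic_on star_compl \<and> B analytic_on star_compl \<and>
     (\<forall>x\<in>star_compl.
        R x ^ 2 = 9 - 4 * x ^ 3 \<and>
        A x ^ 3 = (- 3 + R x) / 2 \<and>
        B x ^ 3 = (- 3 - R x) / 2 \<and>
        A x * B x = x)"

definition Phi_of ::
    "(complex \<Rightarrow> complex) \<Rightarrow> (complex \<Rightarrow> complex) \<Rightarrow> complex \<Rightarrow> complex" where
  "Phi_of A B x =
     1 / (exp (2 * of_real pi * \<i> / 3) * A x ^ 2 + exp (- (2 * of_real pi * \<i> / 3)) * B x ^ 2 + 2 * x)"

end

theory Submission
  imports Defs "HOL-Probability.Distributions" "HOL-Computational_Algebra.Fundamental_Theorem_Algebra"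
begin

text \<open>Write \<open>L p = x\<^sup>2 p - p' / 3\<close>. Integration by parts turns orthogonality of \<open>L p\<close> against \<open>x ^ i\<close> into
  orthogonality of \<open>p\<close> against \<open>x ^ (i - 1)\<close>, and every polynomial is \<open>L p + a + b x\<close>; hence
  \<open>P\<^sub>n = L\<^sup>n 1\<close>. From \<open>P\<^sub>n(x) = x ^ k Q(x\<^sup>3)\<close> one sees that \<open>L\<close> keeps the zeros on the three rays, so
  \<open>P\<^sub>n' / P\<^sub>n\<close> and its derivatives are bounded, after rescaling, locally uniformly off the rays. Inserted in the
  four-term recurrence, this shows that the rescaled ratio \<open>Z\<close> of consecutive polynomials satisfies
  \<open>Z = (x - 1 / (3 Z))\<^sup>2\<close> up to \<open>O(1/n)\<close>. The root \<open>\<Phi>\<close> of this cubic is simple off the rays, and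
  far out it is the only root near \<open>x\<^sup>2\<close>, where \<open>Z\<close> has to be; by continuity \<open>Z\<close> stays close to \<open>\<Phi>\<close>
  on the way back to \<open>K\<close>. The second limit follows from \<open>P\<^sub>n' = 3 x\<^sup>2 P\<^sub>n - 3 P\<^sub>n\<^sub>+\<^sub>1\<close>.\<close>

subsection \<open>Integrals along the rays\<close>

text \<open>The value is Gamma((k+1)/3)/3; the arguments below use only its positivity and its
  three-step recursion.\<close>

definition moment :: "nat \<Rightarrow> real" where
  "moment k = (LBINT t:{0..}. t ^ k * exp (- (t ^ 3)))"

text \<open>Since \<open>t \<le> 1 + t ^ 3\<close> for \<open>t \<ge> 0\<close>, the integrand is
  dominated by \<open>exp 1 * t ^ k * exp (- t)\<close>, whose integral over the half-line is
  \<open>exp 1 * fact k\<close>.\<close>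

lemma set_integrable_power_exp_cube:
  "set_integrable lborel {0..} (\<lambda>t::real. t ^ k * exp (- (t ^ 3)))"
proof -
  have "(\<integral>\<^sup>+t. ennreal (indicator {0..} t * (t ^ k * exp (- t))) \<partial>lborel) =
      (\<integral>\<^sup>+t. ennreal (t ^ k * exp (- t)) * indicator {0..} t \<partial>lborel)"
    by (intro nn_integral_cong) (auto split: split_indicator)
  then have "integrable lborel (\<lambda>t::real. indicator {0..} t * (t ^ k * exp (- t)))"
    by (intro integrableI_nn_integral_finite[where x = "fact k"])
       (auto simp: nn_intergal_power_times_exp_Ici split: split_indicator)
  then have "integrable lborel (\<lambda>t::real. exp 1 * (indicator {0..} t * (t ^ k * exp (- t))))"
    by (rule integrable_mult_right)
  then have "integrable lborel (\<lambda>t::real. indicator {0..} t *\<^sub>R (t ^ k * exp (- (t ^ 3))))"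
  proof (rule Bochner_Integration.integrable_bound)
    show "AE t::real in lborel. norm (indicator {0..} t *\<^sub>R (t ^ k * exp (- (t ^ 3)))) \<le>
        norm (exp 1 * (indicator {0..} t * (t ^ k * exp (- t))))"
    proof (rule AE_I2)
      fix t :: real
      have "exp (- (t ^ 3)) \<le> exp 1 * exp (- t)" if "t \<ge> 0"
      proof -
        have "t \<le> 1 + t ^ 3"
        proof (cases "t \<le> 1")
          case True then show ?thesis using that by (smt (verit) zero_le_power)
        next
          case False then show ?thesis using self_le_power[of t 3] by simp
        qed
        then show ?thesis by (simp flip: exp_add)
      qed
      then have "t ^ k * exp (- (t ^ 3)) \<le> t ^ k * (exp 1 * exp (- t))" if "t \<ge> 0"
        using that by (intro mult_left_mono) auto
      then show "norm (indicator {0..} t *\<^sub>R (t ^ k * exp (- (t ^ 3)))) \<le>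
          norm (exp 1 * (indicator {0..} t * (t ^ k * exp (- t))))"
        by (auto split: split_indicator simp: abs_mult mult_ac)
    qed
  qed measurable
  then show ?thesis by (simp add: set_integrable_def)
qed

text \<open>On [1, 2] the integrand is at least \<open>exp (- 8)\<close>, and on the rest of the
  half-line it is nonnegative.\<close>

lemma moment_pos: "moment k > 0"
proof -
  have "0 < exp (- 8 :: real)" by simp
  also have "\<dots> = (LBINT t:{1..2::real}. exp (- 8))"
    by (simp add: set_lebesgue_integral_def)
  also have "\<dots> \<le> moment k"
    unfolding moment_def set_lebesgue_integral_def
  proof (rule integral_mono)
    show "integrable lborel (\<lambda>t::real. indicator {0..} t *\<^sub>R (t ^ k * exp (- (t ^ 3))))"
      using set_integrable_power_exp_cube by (simp add: set_integrable_def)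
    fix t :: real
    have "exp (- 8) \<le> t ^ k * exp (- (t ^ 3))" if "1 \<le> t" "t \<le> 2"
    proof -
      have "t ^ 3 \<le> 2 ^ 3" using that by (intro power_mono) auto
      then have "1 * exp (- 8) \<le> t ^ k * exp (- (t ^ 3))"
        using that by (intro mult_mono) auto
      then show ?thesis by simp
    qed
    then show "indicator {1..2} t *\<^sub>R exp (- 8) \<le> indicator {0..} t *\<^sub>R (t ^ k * exp (- (t ^ 3)))"
      by (auto split: split_indicator)
  qed auto
  finally show ?thesis .
qed

text \<open>Integration by parts: \<open>F\<close> is an antiderivative of \<open>f\<close> that
  vanishes both at 0 and at infinity.\<close>

lemma moment_rec: "3 * moment (k + 3) = real (k + 1) * moment k"
proof -
  define F where "F = (\<lambda>t::real. t ^ (k + 1) * exp (- (t ^ 3)))"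
  define f where "f = (\<lambda>t::real. real (k + 1) * (t ^ k * exp (- (t ^ 3))) - 3 * (t ^ (k + 3) * exp (- (t ^ 3))))"
  have int: "set_integrable lborel {0..} f"
    unfolding f_def by (intro set_integral_diff set_integrable_mult_right set_integrable_power_exp_cube)
  have "(LBINT t=0..\<infinity>. f t) = 0 - 0"
  proof (rule interval_integral_FTC_integrable)
    show "(F has_vector_derivative f x) (at x)" for x
      unfolding F_def f_def has_real_derivative_iff_has_vector_derivative[symmetric]
      by (rule derivative_eq_intros refl)+ (simp add: algebra_simps power_add eval_nat_numeral)
    show "isCont f x" for x
      unfolding f_def by (intro continuous_intros)
    show "set_integrable lborel (einterval 0 \<infinity>) f"
      by (rule set_integrable_subset[OF int]) (auto simp: einterval_iff)
    have "(F \<longlongrightarrow> F 0) (at_right 0)"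
      unfolding F_def by (intro tendsto_intros)
    then show "((F \<circ> real_of_ereal) \<longlongrightarrow> 0) (at_right 0)"
      by (simp add: zero_ereal_def ereal_tendsto_simps F_def)
    have "(F \<longlongrightarrow> 0) at_top"
      unfolding F_def
    proof (rule tendsto_sandwich[where f = "\<lambda>_. 0" and h = "\<lambda>t. t ^ (k+1) / exp t * exp 1"])
      have "((\<lambda>t::real. t ^ (k+1) / exp t * exp 1) \<longlongrightarrow> 0 * exp 1) at_top"
        by (intro tendsto_intros tendsto_power_div_exp_0)
      then show "((\<lambda>t::real. t ^ (k+1) / exp t * exp 1) \<longlongrightarrow> 0) at_top" by simp
      show "\<forall>\<^sub>F t in at_top. t ^ (k+1) * exp (- (t ^ 3)) \<le> t ^ (k+1) / exp t * exp (1::real)"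
        using eventually_ge_at_top[of 1]
      proof eventually_elim
        case (elim t)
        then have "exp (- (t ^ 3)) \<le> exp 1 / exp t"
          using self_le_power[of t 3] by (simp add: exp_diff[symmetric])
        then show ?case using elim by (auto simp: field_simps)
      qed
      show "\<forall>\<^sub>F t in at_top. 0 \<le> t ^ (k+1) * exp (- (t ^ 3::real))"
        using eventually_ge_at_top[of 0] by eventually_elim simp
    qed auto
    then show "((F \<circ> real_of_ereal) \<longlongrightarrow> 0) (at_left \<infinity>)"
      by (simp add: ereal_tendsto_simps)
  qed auto
  then have "(LBINT t:{0<..}. f t) = 0"
    by (simp add: interval_integral_to_infinity_eq zero_ereal_def)
  \<comment> \<open>The fundamental theorem speaks of the open half-line, \<open>moment\<close> of
    the closed one; they differ by a null set.\<close>
  also have "(LBINT t:{0<..}. f t) = (LBINT t:{0..}. f t)"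
    using AE_lborel_singleton[of 0]
    by (intro set_integral_cong_set)
       (auto simp: set_borel_measurable_def f_def elim!: eventually_mono split: split_indicator)
  also have "\<dots> = real (k + 1) * moment k - 3 * moment (k + 3)"
    unfolding f_def moment_def
    by (subst set_integral_diff)
       (auto intro!: set_integrable_mult_right set_integrable_power_exp_cube simp del: of_nat_add of_nat_Suc)
  finally show ?thesis by simp
qed

section \<open>Cube roots of unity and the moment functionals\<close>

lemma omega_eq: "omega = Complex (- 1 / 2) (sqrt 3 / 2)"
proof -
  have "omega = cis (2 * pi / 3)"
    unfolding omega_def cis_conv_exp by (simp add: mult_ac)
  then show ?thesis
    using cos_120 sin_120 by (simp add: complex_eq_iff mult.commute)
qed

lemma omega_sum: "omega\<^sup>2 + omega + 1 = 0"
  by (simp add: omega_eq complex_eq_iff power2_eq_square)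

lemma omega_cube: "omega ^ 3 = 1"
  using omega_sum by algebra

lemma omega_neq_1: "omega \<noteq> 1"
  by (simp add: omega_eq complex_eq_iff)

lemma omega_power_cube: "(omega ^ j) ^ 3 = 1"
  by (metis omega_cube power_mult mult.commute power_one)

text \<open>This is the contour integral of \<open>x ^ k * exp (- (x ^ 3))\<close>: on ray j the
  monomial contributes \<open>(omega ^ j) ^ k\<close>, and dx contributes one further factor
  \<open>omega ^ j\<close>.\<close>

definition contour_moment :: "nat \<Rightarrow> nat \<Rightarrow> complex" where
  "contour_moment j k = (1 - (omega ^ j) ^ (k + 1)) * of_real (moment k)"

text \<open>Algebraic form of the contour integral against the weight; with it, orthogonality
  becomes a statement about coefficients, free of integrals.\<close>

definition contour_functional :: "nat \<Rightarrow> complex poly \<Rightarrow> complex" where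
  "contour_functional j q = (\<Sum>k\<le>degree q. coeff q k * contour_moment j k)"

text \<open>The weight depends on the cube of the variable only, so a rotation by a cube root of
  unity leaves it unchanged.\<close>

lemma ray_integral:
  fixes q :: "complex poly"
  assumes c: "c ^ 3 = 1"
  shows "(LBINT t:{0..}. poly q (c * of_real t) * exp (- ((c * of_real t) ^ 3))) =
    (\<Sum>k\<le>degree q. coeff q k * c ^ k * of_real (moment k))"
proof -
  have *: "poly q (c * of_real t) * exp (- ((c * of_real t) ^ 3)) =
      (\<Sum>k\<le>degree q. coeff q k * c ^ k * of_real (t ^ k * exp (- (t ^ 3))))" for t :: real
  proof -
    have "(c * of_real t) ^ 3 = of_real (t ^ 3)" by (simp add: c power_mult_distrib)
    then have "exp (- ((c * of_real t) ^ 3)) = of_real (exp (- (t ^ 3)))"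
      by (metis exp_of_real of_real_minus)
    then show ?thesis
      by (simp add: poly_altdef sum_distrib_left power_mult_distrib mult_ac)
  qed
  have int: "set_integrable lborel {0..} (\<lambda>t. of_real (t ^ k * exp (- (t ^ 3))) :: complex)" for k
    using set_integrable_power_exp_cube[of k] integrable_of_real
    by (auto simp: set_integrable_def scaleR_conv_of_real simp flip: of_real_mult)
  have 1: "(LBINT t:{0..}. coeff q k * c ^ k * of_real (t ^ k * exp (- (t ^ 3)))) =
      coeff q k * c ^ k * of_real (moment k)" for k
    unfolding moment_def by (simp only: set_integral_mult_right set_integral_complex_of_real)
  have 2: "set_integrable lborel {0..} (\<lambda>t. coeff q k * c ^ k * of_real (t ^ k * exp (- (t ^ 3))))" for k
    using int by (intro set_integrable_mult_right)
  show ?thesis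
    unfolding * 1[symmetric] set_lebesgue_integral_def scaleR_sum_right
    using 2 by (intro Bochner_Integration.integral_sum) (simp only: set_integrable_def)
qed

lemma contour_int_eq_functional:
  "contour_int j (\<lambda>x. poly q x * exp (- (x ^ 3))) = contour_functional j q"
  using ray_integral[of 1 q] ray_integral[OF omega_power_cube, of q j]
  unfolding contour_int_def contour_functional_def contour_moment_def
  by (simp add: sum_distrib_left algebra_simps sum_subtractf)

text \<open>A common summation bound makes polynomials of different degrees comparable.\<close>

lemma contour_functional_altdef:
  assumes "degree q \<le> N"
  shows "contour_functional j q = (\<Sum>k\<le>N. coeff q k * contour_moment j k)"
  unfolding contour_functional_def
  using assms by (intro sum.mono_neutral_left) (auto simp: coeff_eq_0)

lemma contour_functional_add:
  "contour_functional j (p + q) = contour_functional j p + contour_functional j q"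
proof -
  define N where "N = max (degree p) (degree q)"
  have "degree p \<le> N" "degree q \<le> N" "degree (p + q) \<le> N"
    by (auto simp: N_def intro: degree_add_le)
  then show ?thesis
    by (simp add: contour_functional_altdef[of _ N] algebra_simps sum.distrib)
qed

lemma contour_functional_smult: "contour_functional j (smult c p) = c * contour_functional j p"
  by (simp add: contour_functional_altdef[of "smult c p" "degree p"] degree_smult_le
      contour_functional_def sum_distrib_left mult_ac)

text \<open>Replacing \<open>k - 1\<close> by \<open>k + 2\<close> leaves the factor of
  \<open>contour_moment\<close> unchanged, so \<open>moment_rec\<close> applies. For k = 0 the right
  side vanishes whatever \<open>k - 1\<close> means, and the left side vanishes since
  \<open>(omega ^ j) ^ 3 = 1\<close>.\<close>

lemma contour_moment_rec: "3 * contour_moment j (k + 2) = of_nat k * contour_moment j (k - 1)"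
proof (cases k)
  case 0
  have "(omega ^ j) ^ 3 = 1" by (rule omega_power_cube)
  then show ?thesis by (simp add: 0 contour_moment_def eval_nat_numeral)
next
  case (Suc m)
  have "(omega ^ j) ^ (k + 2 + 1) = (omega ^ j) ^ 3 * (omega ^ j) ^ k"
    unfolding power_add[symmetric] by (simp add: eval_nat_numeral)
  then have *: "(omega ^ j) ^ (k + 2 + 1) = (omega ^ j) ^ k"
    using omega_power_cube[of j] by simp
  have "complex_of_real (3 * moment (m + 3)) = of_real (real (m + 1) * moment m)"
    by (simp only: moment_rec)
  then have **: "3 * complex_of_real (moment (k + 2)) = of_nat k * of_real (moment (k - 1))"
    by (simp add: Suc eval_nat_numeral)
  have "k - 1 + 1 = k" by (simp add: Suc)
  then have "contour_moment j (k - 1) = (1 - (omega ^ j) ^ k) * of_real (moment (k - 1))"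
    by (simp only: contour_moment_def)
  moreover have "contour_moment j (k + 2) = (1 - (omega ^ j) ^ k) * of_real (moment (k + 2))"
    by (simp only: contour_moment_def *)
  ultimately show ?thesis
    using ** by (metis mult.left_commute)
qed

text \<open>The derivative of \<open>p * exp (- (x ^ 3))\<close> integrates to zero, because the
  boundary terms of the two rays cancel at the origin. Here this is read off coefficientwise from
  the moment recursion.\<close>

lemma contour_functional_pderiv:
  "contour_functional j (pderiv p) = 3 * contour_functional j (monom 1 2 * p)"
proof -
  define N where "N = degree p"
  have 1: "degree (pderiv p) \<le> N" "degree (monom 1 2 * p) \<le> Suc (Suc N)"
    using degree_mult_le[of "monom 1 2" p] by (auto simp: N_def degree_pderiv degree_monom_eq)
  have "contour_functional j (pderiv p) =
      (\<Sum>k\<le>N. of_nat (Suc k) * coeff p (Suc k) * contour_moment j k)"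
    by (simp only: contour_functional_altdef[OF 1(1)] coeff_pderiv)
  \<comment> \<open>The new term for k = 0 carries the factor 0; the top term is dropped next
    because its index exceeds the degree.\<close>
  also have "\<dots> = (\<Sum>k\<le>Suc N. of_nat k * coeff p k * contour_moment j (k - 1))"
    by (subst sum.atMost_Suc_shift) simp
  also have "\<dots> = (\<Sum>k\<le>N. of_nat k * coeff p k * contour_moment j (k - 1))"
    by (simp add: N_def coeff_eq_0)
  also have "\<dots> = 3 * (\<Sum>k\<le>N. coeff p k * contour_moment j (k + 2))"
    unfolding sum_distrib_left
  proof (rule sum.cong)
    fix k
    show "of_nat k * coeff p k * contour_moment j (k - 1) = 3 * (coeff p k * contour_moment j (k + 2))"
      using contour_moment_rec[of j k] by algebra
  qed simp
  also have "(\<Sum>k\<le>N. coeff p k * contour_moment j (k + 2)) = contour_functional j (monom 1 2 * p)"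
    unfolding contour_functional_altdef[OF 1(2)] sum.atMost_Suc_shift
    by (simp add: coeff_monom_mult)
  finally show ?thesis .
qed

subsection \<open>The raising operator\<close>

text \<open>\<open>raise p * exp (- (x ^ 3))\<close> is -1/3 times the derivative of
  \<open>p * exp (- (x ^ 3))\<close>, so iterating \<open>raise\<close> on 1 is a Rodrigues
  formula.\<close>

definition raise :: "complex poly \<Rightarrow> complex poly" where
  "raise p = monom 1 2 * p - smult (1 / 3) (pderiv p)"

lemma poly_raise: "poly (raise p) x = x\<^sup>2 * poly p x - poly (pderiv p) x / 3"
  by (simp add: raise_def poly_monom)

text \<open>Up to the factor 1/3, differentiation is adjoint to \<open>raise\<close>. In the
  decomposition of \<open>q * raise p\<close> the first two summands form
  \<open>raise (q * p)\<close>, on which the functional vanishes.\<close>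

lemma contour_functional_raise:
  "contour_functional j (q * raise p) = contour_functional j (pderiv q * p) / 3"
proof -
  have "q * raise p = monom 1 2 * (q * p) + smult (- (1 / 3)) (pderiv (q * p)) + smult (1 / 3) (pderiv q * p)"
    by (simp add: raise_def pderiv_mult algebra_simps smult_add_right)
  then show ?thesis
    by (simp add: contour_functional_add contour_functional_smult contour_functional_pderiv del: smult_minus_left)
qed

lemma is_diag_MOP_iff:
  "is_diag_MOP n p \<longleftrightarrow> lead_coeff p = 1 \<and> degree p = 2 * n \<and>
     (\<forall>j\<in>{1, 2}. \<forall>i<n. contour_functional j (monom 1 i * p) = 0)"
  by (simp add: is_diag_MOP_def poly_monom flip: contour_int_eq_functional)

lemma degree_raise:
  assumes "p \<noteq> 0"
  shows "degree (raise p) = degree p + 2" "lead_coeff (raise p) = lead_coeff p"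
proof -
  have 1: "degree (monom 1 2 * p) = degree p + 2"
    using assms by (subst degree_mult_eq) (auto simp: degree_monom_eq monom_eq_0_iff)
  have 2: "degree (- smult (1 / 3) (pderiv p)) < degree p + 2"
    using degree_smult_le[of "1/3" "pderiv p"] by (simp add: degree_pderiv)
  have eq: "raise p = monom 1 2 * p + - smult (1 / 3) (pderiv p)"
    by (simp add: raise_def)
  show "degree (raise p) = degree p + 2"
    unfolding eq using 1 2 by (subst degree_add_eq_left) auto
  then show "lead_coeff (raise p) = lead_coeff p"
    by (simp add: raise_def coeff_monom_mult coeff_pderiv coeff_eq_0)
qed

text \<open>As in division with remainder, subtracting \<open>raise\<close> of a monomial two
  degrees lower cancels the leading term, until the degree is below 2.\<close>

lemma raise_decomposition: "\<exists>p a b. q = raise p + [:a, b:]"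
proof (induction "degree q" arbitrary: q rule: less_induct)
  case less
  show ?case
  proof (cases "degree q < 2")
    case True
    then have "q = raise 0 + [:coeff q 0, coeff q 1:]"
      by (intro poly_eqI)
         (auto simp: raise_def coeff_pCons coeff_eq_0 split: nat.split)
    then show ?thesis by blast
  next
    case False
    define c where "c = monom (lead_coeff q) (degree q - 2)"
    have "q \<noteq> 0" using False by auto
    then have c: "c \<noteq> 0" "degree c = degree q - 2" "lead_coeff c = lead_coeff q"
      by (auto simp: c_def monom_eq_0_iff degree_monom_eq)
    then have d: "degree (raise c) = degree q" "lead_coeff (raise c) = lead_coeff q"
      using False degree_raise[OF c(1)] by auto
    have "degree (q - raise c) < degree q"
    proof (rule degree_lessI)
      show "q - raise c \<noteq> 0 \<or> degree q > 0" using False by auto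
      show "\<forall>k\<ge>degree q. coeff (q - raise c) k = 0"
        using d by (metis coeff_diff coeff_eq_0 diff_self le_eq_less_or_eq)
    qed
    from less[OF this] obtain p a b where "q - raise c = raise p + [:a, b:]" by blast
    then have "q = raise (p + c) + [:a, b:]"
      by (simp add: raise_def algebra_simps smult_add_right pderiv_add)
    then show ?thesis by blast
  qed
qed

text \<open>After division by \<open>1 - omega\<close> the 2 by 2 system has diagonal entries 1 and
  off-diagonal entries \<open>1 + omega\<close>. Its determinant is \<open>1 - omega\<close>, since
  the square of \<open>1 + omega\<close> is \<open>omega\<close>.\<close>

lemma contour_functional_linear_poly_0:
  assumes "contour_functional 1 [:a, b:] = 0" "contour_functional 2 [:a, b:] = 0"
  shows "a = 0" "b = 0"
proof -
  define A B where "A = a * of_real (moment 0)" and "B = b * of_real (moment 1)"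
  have eq: "contour_functional j [:a, b:] = (1 - omega ^ j) * A + (1 - (omega ^ j)\<^sup>2) * B" for j
    by (simp add: contour_functional_altdef[of _ 1] contour_moment_def A_def B_def power2_eq_square algebra_simps)
  have "(omega\<^sup>2)\<^sup>2 = omega"
    using omega_cube by algebra
  then have 1: "(1 - omega) * A + (1 - omega\<^sup>2) * B = 0" "(1 - omega\<^sup>2) * A + (1 - omega) * B = 0"
    using assms unfolding eq by auto
  have "(1 - omega) * (A + (1 + omega) * B) = 0" "(1 - omega) * ((1 + omega) * A + B) = 0"
    using 1 by (auto simp: algebra_simps power2_eq_square)
  then have "A + (1 + omega) * B = 0" "(1 + omega) * A + B = 0"
    using omega_neq_1 by auto
  then have "(1 - omega) * A = 0" "(1 - omega) * B = 0"
    using omega_sum by algebra+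
  then show "a = 0" "b = 0"
    using omega_neq_1 moment_pos[of 0] moment_pos[of 1] by (auto simp: A_def B_def)
qed

text \<open>Orthogonality to 1 kills the linear remainder of the decomposition; orthogonality to
  \<open>x ^ (i + 1)\<close> passes by adjointness to orthogonality of the preimage to
  \<open>x ^ i\<close>.\<close>

lemma is_diag_MOP_Suc_imp_raise:
  assumes "is_diag_MOP (Suc n) q"
  obtains p where "is_diag_MOP n p" "q = raise p"
proof -
  have q: "lead_coeff q = 1" "degree q = 2 * n + 2"
    and orth: "\<And>j i. j \<in> {1, 2} \<Longrightarrow> i \<le> n \<Longrightarrow> contour_functional j (monom 1 i * q) = 0"
    using assms by (auto simp: is_diag_MOP_iff less_Suc_eq_le)
  obtain p a b where pab: "q = raise p + [:a, b:]"
    using raise_decomposition by blast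
  have "contour_functional j [:a, b:] = 0" if "j \<in> {1, 2}" for j
    using orth[OF that, of 0] contour_functional_raise[of j 1 p] contour_functional_smult[of j 0]
    by (simp add: pab contour_functional_add monom_0 pderiv_1)
  then have "a = 0" "b = 0"
    by (auto intro: contour_functional_linear_poly_0[of a b])
  then have qp: "q = raise p"
    by (simp add: pab)
  then have "p \<noteq> 0" using q by (auto simp: raise_def)
  then have "lead_coeff p = 1" "degree p = 2 * n"
    using degree_raise[of p] q qp by auto
  moreover have "contour_functional j (monom 1 i * p) = 0" if "j \<in> {1, 2}" "i < n" for i j
  proof -
    have "smult (of_nat (Suc i)) (monom 1 i * p) = pderiv (monom 1 (Suc i)) * p"
      by (simp add: pderiv_monom smult_monom flip: mult_smult_left)
    then have "of_nat (Suc i) * contour_functional j (monom 1 i * p) =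
        contour_functional j (pderiv (monom 1 (Suc i)) * p)"
      by (metis contour_functional_smult)
    also have "\<dots> = 3 * contour_functional j (monom 1 (Suc i) * q)"
      by (simp add: qp contour_functional_raise)
    also have "\<dots> = 0" using orth that by simp
    finally show ?thesis by (simp del: of_nat_Suc)
  qed
  ultimately show ?thesis
    using that[OF _ qp] unfolding is_diag_MOP_iff by blast
qed

lemma is_diag_MOP_unique:
  "is_diag_MOP n p \<Longrightarrow> p = (raise ^^ n) 1"
proof (induction n arbitrary: p)
  case 0
  then have "degree p = 0" "lead_coeff p = 1"
    by (auto simp: is_diag_MOP_def)
  then show ?case
    by (auto elim!: degree_eq_zeroE simp: one_pCons)
next
  case (Suc n)
  then obtain q where "is_diag_MOP n q" "p = raise q"
    by (blast elim: is_diag_MOP_Suc_imp_raise)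
  with Suc.IH show ?case by simp
qed

subsection \<open>Location of the zeros\<close>

text \<open>For the roots of p counted with multiplicity, the sums with i = 1, 2, 3 are p'/p, minus
  its first derivative, and half its second derivative.\<close>

definition inverse_power_sum :: "complex multiset \<Rightarrow> complex \<Rightarrow> nat \<Rightarrow> complex" where
  "inverse_power_sum A x i = (\<Sum>a\<in>#A. 1 / (x - a) ^ i)"

lemma norm_inverse_power_sum_le:
  assumes "\<And>a. a \<in># A \<Longrightarrow> d \<le> norm (x - a)" "d > 0"
  shows "norm (inverse_power_sum A x i) \<le> size A / d ^ i"
  using assms(1)
proof (induction A)
  case empty
  then show ?case by (simp add: inverse_power_sum_def)
next
  case (add a A)
  have "d ^ i \<le> norm (x - a) ^ i"
    using add.prems[of a] assms(2) by (intro power_mono) auto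
  then have "norm (1 / (x - a) ^ i) \<le> 1 / d ^ i"
    using assms(2) by (simp add: norm_divide norm_power frac_le)
  moreover have "norm (inverse_power_sum A x i) \<le> size A / d ^ i"
    using add by simp
  ultimately have "norm (1 / (x - a) ^ i + inverse_power_sum A x i) \<le> 1 / d ^ i + size A / d ^ i"
    by (intro norm_triangle_mono)
  then show ?case
    by (simp add: inverse_power_sum_def add_divide_distrib)
qed

text \<open>The formulas are those obtained by differentiating p' = p s1 with s1' = - s2 and s2' = -
  2 s3. Adding one root at a time keeps the proof purely algebraic.\<close>

lemma pderivs_linear_prod:
  fixes A :: "complex multiset"
  assumes "\<And>a. a \<in># A \<Longrightarrow> x \<noteq> a"
  defines "p \<equiv> \<Prod>a\<in>#A. [:- a, 1:]"
  defines "s \<equiv> inverse_power_sum A x"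
  shows "poly (pderiv p) x = poly p x * s 1 \<and>
    poly (pderiv (pderiv p)) x = poly p x * (s 1 ^ 2 - s 2) \<and>
    poly (pderiv (pderiv (pderiv p))) x = poly p x * (s 1 ^ 3 - 3 * s 1 * s 2 + 2 * s 3)"
  using assms(1) unfolding p_def s_def
proof (induction A)
  case empty
  then show ?case by (simp add: inverse_power_sum_def)
next
  case (add a A)
  define q where "q = (\<Prod>a\<in>#A. [:- a, 1:])"
  define s where "s = inverse_power_sum A x"
  define h where "h = 1 / (x - a)"
  have h: "(x - a) * h = 1"
    using add.prems[of a] by (simp add: h_def)
  have prod: "(\<Prod>a\<in>#add_mset a A. [:- a, 1:]) = [:- a, 1:] * q"
    by (simp add: q_def)
  have e: "pderiv ([:- a, 1:] * r) = [:- a, 1:] * pderiv r + r" for r :: "complex poly"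
    by (simp only: pderiv_mult) (simp add: pderiv_pCons)
  have d: "poly (pderiv (\<Prod>a\<in>#add_mset a A. [:- a, 1:])) x = (x - a) * poly (pderiv q) x + poly q x"
    "poly (pderiv (pderiv (\<Prod>a\<in>#add_mset a A. [:- a, 1:]))) x =
       (x - a) * poly (pderiv (pderiv q)) x + 2 * poly (pderiv q) x"
    "poly (pderiv (pderiv (pderiv (\<Prod>a\<in>#add_mset a A. [:- a, 1:])))) x =
       (x - a) * poly (pderiv (pderiv (pderiv q))) x + 3 * poly (pderiv (pderiv q)) x"
    "poly (\<Prod>a\<in>#add_mset a A. [:- a, 1:]) x = (x - a) * poly q x"
    unfolding prod by (simp_all only: e pderiv_add poly_add poly_mult) (simp_all add: algebra_simps)
  have s: "inverse_power_sum (add_mset a A) x i = s i + h ^ i" for i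
    by (simp add: inverse_power_sum_def s_def h_def power_one_over)
  have IH: "poly (pderiv q) x = poly q x * s 1"
    "poly (pderiv (pderiv q)) x = poly q x * (s 1 ^ 2 - s 2)"
    "poly (pderiv (pderiv (pderiv q))) x = poly q x * (s 1 ^ 3 - 3 * s 1 * s 2 + 2 * s 3)"
    using add.IH add.prems unfolding q_def s_def by auto
  \<comment> \<open>The new root shifts each power sum by \<open>h ^ i\<close>; given
    \<open>(x - a) * h = 1\<close>, the claims are polynomial identities.\<close>
  show ?case
    unfolding d s IH power_one_right using h by (intro conjI; algebra)
qed

lemma pderivs_proots:
  fixes p :: "complex poly"
  assumes "poly p x \<noteq> 0"
  defines "s \<equiv> inverse_power_sum (proots p) x"
  shows "poly (pderiv p) x = poly p x * s 1"
    "poly (pderiv (pderiv p)) x = poly p x * (s 1 ^ 2 - s 2)"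
    "poly (pderiv (pderiv (pderiv p))) x = poly p x * (s 1 ^ 3 - 3 * s 1 * s 2 + 2 * s 3)"
proof -
  define q where "q = (\<Prod>a\<in>#proots p. [:- a, 1:])"
  have "p = smult (lead_coeff p) q"
    unfolding q_def by (rule complex_poly_decompose_multiset[symmetric])
  then obtain c where p: "p = smult c q" by blast
  have "x \<noteq> a" if "a \<in># proots p" for a
    using that assms(1) by (cases "p = 0") auto
  then have "poly (pderiv q) x = poly q x * s 1 \<and>
    poly (pderiv (pderiv q)) x = poly q x * (s 1 ^ 2 - s 2) \<and>
    poly (pderiv (pderiv (pderiv q))) x = poly q x * (s 1 ^ 3 - 3 * s 1 * s 2 + 2 * s 3)"
    unfolding q_def s_def by (intro pderivs_linear_prod) blast
  then show "poly (pderiv p) x = poly p x * s 1"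
    "poly (pderiv (pderiv p)) x = poly p x * (s 1 ^ 2 - s 2)"
    "poly (pderiv (pderiv (pderiv p))) x = poly p x * (s 1 ^ 3 - 3 * s 1 * s 2 + 2 * s 3)"
    by (simp_all add: p pderiv_smult)
qed

text \<open>Each summand z/(z - a) with real a \<ge> 0 has imaginary part - a Im z / |z - a|^2, and
  it is nonnegative when z is real and negative. Both properties survive summation.\<close>

lemma inverse_sum_nonneg_Reals:
  assumes "\<And>a. a \<in># A \<Longrightarrow> a \<in> \<real>\<^sub>\<ge>\<^sub>0" "z \<notin> \<real>\<^sub>\<ge>\<^sub>0"
  shows "(\<exists>S\<ge>0. Im (z * inverse_power_sum A z 1) = - S * Im z) \<and>
    (Im z = 0 \<longrightarrow> Re (z * inverse_power_sum A z 1) \<ge> 0)"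
  using assms(1)
proof (induction A)
  case empty
  then show ?case by (auto simp: inverse_power_sum_def)
next
  case (add a A)
  have "z * inverse_power_sum (add_mset a A) z 1 = z / (z - a) + z * inverse_power_sum A z 1"
    by (simp add: inverse_power_sum_def algebra_simps)
  moreover obtain S where "S \<ge> 0" "Im (z * inverse_power_sum A z 1) = - S * Im z"
      "Im z = 0 \<Longrightarrow> Re (z * inverse_power_sum A z 1) \<ge> 0"
    using add by auto
  moreover obtain r where r: "a = of_real r" "r \<ge> 0"
    using add.prems[of a] by (auto elim: nonneg_Reals_cases)
  have "Im (z / (z - a)) = - (r / (norm (z - a))\<^sup>2) * Im z"
    by (simp add: r Im_divide cmod_power2 algebra_simps divide_simps)
  moreover have "Re (z / (z - a)) \<ge> 0" if "Im z = 0"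
  proof -
    have "Re z < 0" using that assms(2) by (auto simp: complex_nonneg_Reals_iff)
    then have "Re z * (Re z - r) \<ge> 0" using r by (intro mult_nonpos_nonpos) auto
    then show ?thesis using that by (simp add: r Re_divide)
  qed
  moreover have "r / (norm (z - a))\<^sup>2 \<ge> 0" using r by simp
  ultimately show ?case
    by (auto intro!: exI[of _ "r / (norm (z - a))\<^sup>2 + S"] simp: algebra_simps)
qed

text \<open>Comparing imaginary parts in \<open>z - \<kappa> = (\<Sum>a. z / (z - a))\<close> forces \<open>z\<close> to be real, and then
  comparing signs excludes negative \<open>z\<close>.\<close>

lemma logderiv_eq_imp_nonneg_Reals:
  fixes Q :: "complex poly"
  assumes Q: "\<And>z. poly Q z = 0 \<Longrightarrow> z \<in> \<real>\<^sub>\<ge>\<^sub>0"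
    and eq: "(z - of_real \<kappa>) * poly Q z = z * poly (pderiv Q) z" and "\<kappa> \<ge> 0"
  shows "z \<in> \<real>\<^sub>\<ge>\<^sub>0"
proof (rule ccontr)
  assume z: "z \<notin> \<real>\<^sub>\<ge>\<^sub>0"
  then have nz: "poly Q z \<noteq> 0" using Q by blast
  then have "Q \<noteq> 0" by auto
  have "z - of_real \<kappa> = z * inverse_power_sum (proots Q) z 1"
  proof -
    have "(z - of_real \<kappa>) * poly Q z = (z * inverse_power_sum (proots Q) z 1) * poly Q z"
      unfolding eq pderivs_proots(1)[OF nz] by simp
    then show ?thesis using nz by simp
  qed
  then have *: "Im (z * inverse_power_sum (proots Q) z 1) = Im z" "Re (z * inverse_power_sum (proots Q) z 1) = Re z - \<kappa>"
    by (metis Im_complex_of_real minus_complex.simps diff_zero Re_complex_of_real)+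
  have "a \<in> \<real>\<^sub>\<ge>\<^sub>0" if "a \<in># proots Q" for a
    using Q that \<open>Q \<noteq> 0\<close> by auto
  from inverse_sum_nonneg_Reals[where A = "proots Q", OF this z, unfolded *]
  obtain S where S: "S \<ge> 0" "Im z = - S * Im z" "Im z = 0 \<longrightarrow> Re z - \<kappa> \<ge> 0"
    by blast
  have "(1 + S) * Im z = 0" using S(2) by (simp add: algebra_simps)
  then have "Im z = 0" using S(1) by auto
  with S(3) \<open>\<kappa> \<ge> 0\<close> z show False
    by (auto simp: complex_nonneg_Reals_iff)
qed

text \<open>In the variable z = x^3, \<open>raise\<close> sends (0, Q) to (2, Q - Q') and (k, Q)
  with k > 0 to (k - 1, (z - k/3) Q - z Q'). The roots of the new factor satisfy the logarithmic
  derivative equation with \<kappa> = 0 or \<kappa> = k/3, hence are again real and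
  nonnegative.\<close>

lemma raise_iterate_symmetric:
  "\<exists>k Q. (\<forall>z. poly Q z = 0 \<longrightarrow> z \<in> \<real>\<^sub>\<ge>\<^sub>0) \<and> (raise ^^ n) 1 = monom 1 k * pcompose Q (monom 1 3)"
proof (induction n)
  case 0
  show ?case by (intro exI[of _ 0] exI[of _ 1]) (auto simp: monom_0 pcompose_1)
next
  case (Suc n)
  then obtain k Q where Q: "\<And>z. poly Q z = 0 \<Longrightarrow> z \<in> \<real>\<^sub>\<ge>\<^sub>0"
    and p: "(raise ^^ n) 1 = monom 1 k * pcompose Q (monom 1 3)" by blast
  define p where "p = monom 1 k * pcompose Q (monom 1 3)"
  have p': "poly (pderiv p) x = of_nat k * x ^ (k - 1) * poly Q (x ^ 3) + 3 * x ^ (k + 2) * poly (pderiv Q) (x ^ 3)" for x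
    by (simp add: p_def pderiv_mult pderiv_pcompose pderiv_monom poly_pcompose poly_monom power_add power2_eq_square algebra_simps)
  have px: "poly p x = x ^ k * poly Q (x ^ 3)" for x
    by (simp add: p_def poly_pcompose poly_monom)
  have "\<exists>l Q'. (\<forall>z. poly Q' z = 0 \<longrightarrow> z \<in> \<real>\<^sub>\<ge>\<^sub>0) \<and> (\<forall>x. poly (raise p) x = x ^ l * poly Q' (x ^ 3))"
  proof (cases k)
    case 0
    have "z \<in> \<real>\<^sub>\<ge>\<^sub>0" if "poly (Q - pderiv Q) z = 0" for z
      using that by (intro logderiv_eq_imp_nonneg_Reals[of Q z 0] Q) auto
    moreover have "poly (raise p) x = x ^ 2 * poly (Q - pderiv Q) (x ^ 3)" for x
      by (simp add: poly_raise p' px 0 power2_eq_square algebra_simps)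
    ultimately show ?thesis by blast
  next
    case (Suc l)
    define Q' where "Q' = [:- of_real (real k / 3), 1:] * Q - [:0, 1:] * pderiv Q"
    have "z \<in> \<real>\<^sub>\<ge>\<^sub>0" if "poly Q' z = 0" for z
      using that by (intro logderiv_eq_imp_nonneg_Reals[of Q z "real k / 3"] Q) (auto simp: Q'_def algebra_simps)
    moreover have "poly (raise p) x = x ^ l * poly Q' (x ^ 3)" for x
      by (simp add: poly_raise p' px Q'_def Suc algebra_simps power_add add_divide_distrib)
        (simp add: power2_eq_square power3_eq_cube)
    ultimately show ?thesis by blast
  qed
  then obtain l Q' where Q': "\<And>z. poly Q' z = 0 \<Longrightarrow> z \<in> \<real>\<^sub>\<ge>\<^sub>0"
    and r: "\<And>x. poly (raise p) x = x ^ l * poly Q' (x ^ 3)" by blast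
  have "raise p = monom 1 l * pcompose Q' (monom 1 3)"
    by (intro poly_eqI_degree[of UNIV] poly_ext) (simp add: r poly_pcompose poly_monom)
  then show ?case using Q' p by (auto simp: p_def)
qed

text \<open>If x^3 is real and nonnegative with real cube root r, the three linear factors of x^3 -
  r^3 correspond to the three rays.\<close>

lemma star_compl_iff: "x \<in> star_compl \<longleftrightarrow> x ^ 3 \<notin> \<real>\<^sub>\<ge>\<^sub>0"
proof -
  have "x ^ 3 \<in> \<real>\<^sub>\<ge>\<^sub>0" if "x \<in> Gamma_ray k" for k
    using that omega_power_cube[of k]
    by (auto simp: Gamma_ray_def power_mult_distrib simp flip: of_real_power)
  moreover have "\<exists>k\<in>{0,1,2}. x \<in> Gamma_ray k" if "x ^ 3 \<in> \<real>\<^sub>\<ge>\<^sub>0"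
  proof -
    from that obtain \<rho> where \<rho>: "x ^ 3 = of_real \<rho>" "\<rho> \<ge> 0"
      by (auto elim: nonneg_Reals_cases)
    define r where "r = root 3 \<rho>"
    have r: "r \<ge> 0" "x ^ 3 = of_real r ^ 3"
      using \<rho> by (auto simp: r_def simp flip: of_real_power)
    have "(x - of_real r) * (x - of_real r * omega) * (x - of_real r * omega\<^sup>2) = x ^ 3 - of_real r ^ 3"
      using omega_sum by algebra
    then have "x = of_real r * omega ^ 0 \<or> x = of_real r * omega ^ 1 \<or> x = of_real r * omega ^ 2"
      using r by auto
    then show ?thesis using r by (auto simp: Gamma_ray_def)
  qed
  ultimately show ?thesis unfolding star_compl_def by auto
qed

lemma raise_iterate_root_notin_star_compl:
  "poly ((raise ^^ n) 1) x = 0 \<Longrightarrow> x \<notin> star_compl"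
  using raise_iterate_symmetric[of n]
  by (auto simp: star_compl_iff poly_monom poly_pcompose)

section \<open>The four-term recurrence\<close>

text \<open>Applying \<open>raise\<close> to the recurrence yields the next one: its commutators
  with multiplication by x and x^2 produce exactly the increments of the coefficients.\<close>

lemma raise_iterate_recurrence:
  fixes n :: nat
  defines "P \<equiv> \<lambda>n. (raise ^^ n) 1"
  shows "P (n + 3) = monom 1 2 * P (n + 2) - smult (2 * (of_nat n + 2) / 3) (monom 1 1 * P (n + 1))
     + smult ((of_nat n + 1) * (of_nat n + 2) / 9) (P n)"
proof (induction n)
  case 0
  have "poly (P 3) x = poly (monom 1 2 * P 2 - smult (4 / 3) (monom 1 1 * P 1) + smult (2 / 9) (P 0)) x" for x
    by (simp add: P_def eval_nat_numeral poly_monom raise_def pderiv_diff pderiv_mult pderiv_monom pderiv_smult pderiv_1 algebra_simps)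
  then have "P 3 = monom 1 2 * P 2 - smult (4 / 3) (monom 1 1 * P 1) + smult (2 / 9) (P 0)"
    by (intro poly_ext) blast
  then show ?case by (simp del: add_2_eq_Suc')
next
  case (Suc n)
  have raise_add: "raise (p + q) = raise p + raise q" "raise (p - q) = raise p - raise q"
      "raise (smult c p) = smult c (raise p)" for p q c
    by (auto simp: raise_def pderiv_add pderiv_diff pderiv_smult algebra_simps smult_add_right smult_diff_right)
  have raise_x: "raise (monom 1 1 * p) = monom 1 1 * raise p - smult (1 / 3) p"
     "raise (monom 1 2 * p) = monom 1 2 * raise p - smult (2 / 3) (monom 1 1 * p)" for p
    by (rule poly_ext, simp add: poly_raise pderiv_mult pderiv_monom poly_monom field_simps)+
  have P_Suc: "P (Suc n) = raise (P n)" for n by (simp add: P_def)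
  have r: "raise (P (n + 2)) = P (n + 3)" "raise (P (n + 1)) = P (n + 2)" "raise (P n) = P (n + 1)"
    by (simp_all add: P_Suc eval_nat_numeral)
  have "P (Suc n + 3) = raise (P (n + 3))" by (simp only: add_Suc P_Suc)
  also have "\<dots> = raise (monom 1 2 * P (n + 2) - smult (2 * (of_nat n + 2) / 3) (monom 1 1 * P (n + 1))
     + smult ((of_nat n + 1) * (of_nat n + 2) / 9) (P n))"
    by (simp only: Suc.IH)
  also have "\<dots> = monom 1 2 * P (n + 3) - smult (2 / 3) (monom 1 1 * P (n + 2)) -
     smult (2 * (of_nat n + 2) / 3) (monom 1 1 * P (n + 2) - smult (1 / 3) (P (n + 1))) +
     smult ((of_nat n + 1) * (of_nat n + 2) / 9) (P (n + 1))"
    by (simp only: raise_add raise_x r)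
  also have "\<dots> = monom 1 2 * P (Suc n + 2) - smult (2 * (of_nat (Suc n) + 2) / 3) (monom 1 1 * P (Suc n + 1))
     + smult ((of_nat (Suc n) + 1) * (of_nat (Suc n) + 2) / 9) (P (Suc n))"
    by (rule poly_ext) (simp add: field_simps eval_nat_numeral)
  finally show ?case .
qed

subsection \<open>The approximate cubic equation\<close>

lemma degree_raise_iterate: "(raise ^^ n) 1 \<noteq> 0 \<and> degree ((raise ^^ n) 1) = 2 * n"
  by (induction n) (use degree_raise in force)+

lemma pderiv_raise: "pderiv (raise p) = monom 2 1 * p + monom 1 2 * pderiv p - smult (1 / 3) (pderiv (pderiv p))"
  by (simp add: raise_def pderiv_diff pderiv_mult pderiv_monom pderiv_smult)

text \<open>\<open>R\<close> is the ratio of consecutive polynomials, \<open>D\<close> its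
  derivative and \<open>E\<close> its second derivative. Raising p twice and three times multiplies
  it by \<open>R ^ 2 - D / 3\<close> and \<open>R ^ 3 - R * D + E / 9\<close>; the identity is the
  recurrence divided by p.\<close>

lemma raise_iterate_ratio:
  fixes n :: nat
  defines "p \<equiv> (raise ^^ n) 1"
  assumes nz: "poly p x \<noteq> 0"
  defines "s \<equiv> inverse_power_sum (proots p) x"
  defines "R \<equiv> x\<^sup>2 - s 1 / 3" and "D \<equiv> 2 * x + s 2 / 3" and "E \<equiv> 2 - 2 / 3 * s 3"
  shows "poly (raise p) x = poly p x * R"
    and "R ^ 3 - R * D + E / 9 = x\<^sup>2 * (R\<^sup>2 - D / 3) - 2 * (of_nat n + 2) / 3 * x * R
      + (of_nat n + 1) * (of_nat n + 2) / 9"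
proof -
  define p0 p1 p2 p3 where "p0 = poly p x" and "p1 = poly (pderiv p) x"
    and "p2 = poly (pderiv (pderiv p)) x" and "p3 = poly (pderiv (pderiv (pderiv p))) x"
  have ps: "p1 = p0 * s 1" "p2 = p0 * (s 1 ^ 2 - s 2)" "p3 = p0 * (s 1 ^ 3 - 3 * s 1 * s 2 + 2 * s 3)"
    unfolding p0_def p1_def p2_def p3_def s_def by (rule pderivs_proots[OF nz])+
  have e1: "poly (raise p) x = p0 * R"
    by (simp add: poly_raise p0_def[symmetric] p1_def[symmetric] ps R_def field_simps)
  then show "poly (raise p) x = poly p x * R" by (simp add: p0_def)
  have d1: "poly (pderiv (raise p)) x = 2 * x * p0 + x\<^sup>2 * p1 - p2 / 3"
    by (simp add: pderiv_raise poly_monom p0_def p1_def p2_def)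
  have d2: "poly (pderiv (pderiv (raise p))) x = 2 * p0 + 4 * x * p1 + x\<^sup>2 * p2 - p3 / 3"
    by (simp add: pderiv_raise pderiv_diff pderiv_add pderiv_mult pderiv_monom pderiv_smult poly_monom
        p0_def p1_def p2_def p3_def)
  have e2: "poly (raise (raise p)) x = p0 * (R\<^sup>2 - D / 3)"
    unfolding poly_raise[of "raise p"] e1 d1 ps R_def D_def by (simp add: field_simps power2_eq_square)
  have d3: "poly (pderiv (raise (raise p))) x = 2 * x * (p0 * R) + x\<^sup>2 * poly (pderiv (raise p)) x -
      poly (pderiv (pderiv (raise p))) x / 3"
    by (simp add: pderiv_raise[of "raise p"] poly_monom e1)
  have e3: "poly (raise (raise (raise p))) x = p0 * (R ^ 3 - R * D + E / 9)"
    unfolding poly_raise[of "raise (raise p)"] e2 d3 d1 d2 ps R_def D_def E_def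
    by (simp add: field_simps power2_eq_square power3_eq_cube)
  have "poly (raise (raise (raise p))) x = x\<^sup>2 * poly (raise (raise p)) x -
      2 * (of_nat n + 2) / 3 * (x * poly (raise p) x) + (of_nat n + 1) * (of_nat n + 2) / 9 * p0"
    using arg_cong[OF raise_iterate_recurrence[of n], of "\<lambda>q. poly q x"]
    by (simp add: p_def p0_def poly_monom eval_nat_numeral)
  then have "p0 * (R ^ 3 - R * D + E / 9) = p0 * (x\<^sup>2 * (R\<^sup>2 - D / 3) - 2 * (of_nat n + 2) / 3 * x * R
      + (of_nat n + 1) * (of_nat n + 2) / 9)"
    unfolding e1 e2 e3 by (simp add: algebra_simps)
  then show "R ^ 3 - R * D + E / 9 = x\<^sup>2 * (R\<^sup>2 - D / 3) - 2 * (of_nat n + 2) / 3 * x * R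
      + (of_nat n + 1) * (of_nat n + 2) / 9"
    using nz by (simp add: p0_def)
qed

lemma star_compl_scale:
  assumes "c > 0"
  shows "of_real c * x \<in> star_compl \<longleftrightarrow> x \<in> star_compl"
proof -
  have "of_real c * z \<in> \<real>\<^sub>\<ge>\<^sub>0 \<longleftrightarrow> z \<in> \<real>\<^sub>\<ge>\<^sub>0" if "c > 0" for z :: complex and c :: real
    using that by (auto simp: complex_nonneg_Reals_iff zero_le_mult_iff)
  from this[of "c ^ 3" "x ^ 3"] assms show ?thesis
    by (simp add: star_compl_iff power_mult_distrib)
qed

text \<open>Vanishing of this polynomial is z = (y - 1/(3z))^2 cleared of denominators; it is also
  the leading order of the rescaled recurrence.\<close>

definition spectral_cubic :: "complex \<Rightarrow> complex \<Rightarrow> complex" where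
  "spectral_cubic y z = z ^ 3 - y\<^sup>2 * z\<^sup>2 + 2 / 3 * y * z - 1 / 9"

text \<open>The scale n and the index m are separate because the two limits need m = n - 1 and m = n
  at the same scale.\<close>

definition scaled_ratio :: "nat \<Rightarrow> nat \<Rightarrow> complex \<Rightarrow> complex" where
  "scaled_ratio n m y = (let x = of_real (real n powr (1/3)) * y in
     poly ((raise ^^ Suc m) 1) x / poly ((raise ^^ m) 1) x / of_real (real n powr (1/3)) ^ 2)"

text \<open>With c = n^(1/3) the zeros stay at distance c d from x = c y, so the i-th inverse power
  sum is O(c^(3-i)). Thus R, D, E are O(c^2), O(c), O(1), and every term missing from the cubic is
  O(c^3) = O(n), against a main order of n^2.\<close>

lemma scaled_ratio_estimate:
  assumes "d > 0" and "Y \<ge> 0"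
  shows "\<exists>C\<ge>0. \<forall>n\<ge>1. \<forall>m y. m \<le> n \<longrightarrow> n \<le> m + 1 \<longrightarrow> norm y \<le> Y \<longrightarrow>
      (\<forall>a. a \<notin> star_compl \<longrightarrow> d \<le> norm (y - a)) \<longrightarrow>
      norm (scaled_ratio n m y - y\<^sup>2) \<le> 2 / (3 * d) \<and>
      norm (spectral_cubic y (scaled_ratio n m y)) \<le> C / real n"
proof -
  \<comment> \<open>\<open>B\<close>, \<open>D0\<close> and \<open>E0\<close> bound |R|/c^2, |D|/c
    and |E|; \<open>C\<close> collects the resulting error terms.\<close>
  define B where "B = Y\<^sup>2 + 2 / (3 * d)"
  define D0 where "D0 = 2 * Y + 2 / (3 * d\<^sup>2)"
  define E0 where "E0 = 2 + 4 / (3 * d ^ 3)"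
  define C where "C = B * D0 + Y\<^sup>2 * D0 / 3 + E0 / 9 + 4 / 3 * Y * B + 5 / 9"
  have pos: "B \<ge> 0" "D0 \<ge> 0" "E0 \<ge> 0" using assms by (auto simp: B_def D0_def E0_def)
  show ?thesis
  proof (intro exI[of _ C] conjI[of "C \<ge> 0"] allI impI)
    show "C \<ge> 0" unfolding C_def using pos assms by auto
    fix n m :: nat and y :: complex
    assume n1: "1 \<le> n" and m: "m \<le> n" "n \<le> m + 1" and y: "norm y \<le> Y"
      and dist: "\<forall>a. a \<notin> star_compl \<longrightarrow> d \<le> norm (y - a)"
    define c where "c = real n powr (1/3)"
    have n: "real n = c ^ 3" and c: "c \<ge> 1"
      using n1 by (auto simp: c_def powr_power ge_one_powr_ge_zero)
    define p where "p = (raise ^^ m) 1"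
    define x where "x = of_real c * y"
    define s where "s = inverse_power_sum (proots p) x"
    define R D E where "R = x\<^sup>2 - s 1 / 3" and "D = 2 * x + s 2 / 3" and "E = 2 - 2 / 3 * s 3"
    define Z where "Z = R / of_real c ^ 2"
    have cd: "c * d > 0" using c assms by simp
    have dist': "c * d \<le> norm (x - a)" if "a \<notin> star_compl" for a
    proof -
      have "of_real (1 / c) * a \<notin> star_compl"
        using star_compl_scale[of "1 / c" a] c that by simp
      then have "c * d \<le> c * norm (y - of_real (1 / c) * a)"
        using dist c by simp
      also have "\<dots> = norm (of_real c * (y - of_real (1 / c) * a))"
        using c by (simp add: norm_mult)
      also have "of_real c * (y - of_real (1 / c) * a) = x - a"
        using c by (simp add: x_def algebra_simps)
      finally show ?thesis .
    qed
    have nz: "poly p x \<noteq> 0"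
      using dist'[of x] cd raise_iterate_root_notin_star_compl[of m x] by (auto simp: p_def)
    have "norm (s i) \<le> real (size (proots p)) / (c * d) ^ i" for i
      unfolding s_def
    proof (rule norm_inverse_power_sum_le)
      fix a assume "a \<in># proots p"
      then have "poly p a = 0" by (cases "p = 0") auto
      then show "c * d \<le> norm (x - a)"
        using dist' raise_iterate_root_notin_star_compl[of m a] by (auto simp: p_def)
    qed fact
    also have "real (size (proots p)) / (c * d) ^ i \<le> 2 * c ^ 3 / (c * d) ^ i" for i
      using m degree_raise_iterate[of m] cd unfolding n[symmetric]
      by (intro divide_right_mono) (auto simp: p_def size_proots_complex)
    finally have s: "norm (s i) \<le> 2 * c ^ 3 / (c * d) ^ i" for i .
    have s1: "norm (s 1) \<le> c\<^sup>2 * (2 / d)"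
      using s[of 1] c assms(1) by (simp add: power2_eq_square power3_eq_cube mult_ac)
    have s2: "norm (s 2) \<le> c * (2 / d\<^sup>2)"
      using s[of 2] c assms(1) by (simp add: power2_eq_square power3_eq_cube mult_ac)
    have s3: "norm (s 3) \<le> 2 / d ^ 3"
      using s[of 3] c assms(1) by (simp add: power3_eq_cube)
    have x: "norm x \<le> c * Y" using y c by (simp add: x_def norm_mult)
    have x2: "norm (x\<^sup>2) \<le> c\<^sup>2 * Y\<^sup>2"
      using power_mono[OF x, of 2] by (simp add: norm_power power_mult_distrib)
    have "norm R \<le> norm (x\<^sup>2) + norm (s 1 / 3)"
      unfolding R_def by (rule norm_triangle_ineq4)
    then have R: "norm R \<le> c\<^sup>2 * B"
      using x2 s1 by (simp add: B_def algebra_simps)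
    have "norm D \<le> norm (2 * x) + norm (s 2 / 3)"
      unfolding D_def by (rule norm_triangle_ineq)
    also have "\<dots> = 2 * norm x + norm (s 2) / 3"
      by (simp add: norm_mult)
    also have "\<dots> \<le> 2 * (c * Y) + c * (2 / d\<^sup>2) / 3"
      by (intro add_mono mult_left_mono divide_right_mono x s2) simp_all
    also have "\<dots> = c * D0"
      by (simp add: D0_def field_simps)
    finally have D: "norm D \<le> c * D0" .
    have "norm E \<le> norm (2 :: complex) + norm (2 / 3 * s 3)"
      unfolding E_def by (rule norm_triangle_ineq4)
    then have E: "norm E \<le> E0"
      using s3 by (simp add: E0_def norm_mult)
    have ratio: "poly (raise p) x = poly p x * R"
      and eq: "R ^ 3 - R * D + E / 9 = x\<^sup>2 * (R\<^sup>2 - D / 3) - 2 * (of_nat m + 2) / 3 * x * R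
        + (of_nat m + 1) * (of_nat m + 2) / 9"
      using raise_iterate_ratio[of m x] nz unfolding p_def R_def D_def E_def s_def by blast+
    have Z: "scaled_ratio n m y = Z"
      using nz ratio by (simp add: Z_def scaled_ratio_def p_def x_def c_def Let_def)
    have "Z - y\<^sup>2 = - (s 1 / 3 / of_real c ^ 2)"
      using c by (simp add: Z_def R_def x_def power_mult_distrib field_simps)
    then have "norm (Z - y\<^sup>2) = norm (s 1) / 3 / c\<^sup>2"
      using c by (simp add: norm_divide norm_power)
    also have "\<dots> \<le> 2 / (3 * d)"
      using s1 c assms(1) by (simp add: field_simps)
    finally have est1: "norm (Z - y\<^sup>2) \<le> 2 / (3 * d)" .
    \<comment> \<open>\<open>k\<close> and \<open>l\<close> record how far the recurrence
      coefficients with m differ from 2n/3 and n^2/9; as m is n - 1 or n, they are O(1) and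
      O(n).\<close>
    define k where "k = (real n - real m - 2)"
    define l where "l = (real m + 1) * (real m + 2) - (real n)\<^sup>2"
    have k: "\<bar>k\<bar> \<le> 2" using m by (auto simp: k_def)
    have l: "\<bar>l\<bar> \<le> 5 * real n"
    proof -
      consider "n = m" | "n = m + 1" using m by linarith
      then show ?thesis
        using n1 by cases (auto simp: l_def algebra_simps power2_eq_square)
    qed
    \<comment> \<open>Undoing the scaling multiplies the cubic by n^2. Substituting the recurrence
      for \<open>R ^ 3\<close> then cancels all main terms.\<close>
    have "of_real (c ^ 3) ^ 2 * spectral_cubic y Z =
        R ^ 3 - x\<^sup>2 * R\<^sup>2 + 2 / 3 * of_real (c ^ 3) * x * R - of_real (c ^ 3) ^ 2 / 9"
      using c by (simp add: spectral_cubic_def Z_def x_def field_simps eval_nat_numeral)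
    also have "\<dots> = R * D - x\<^sup>2 * D / 3 - E / 9 + of_real (2 / 3 * k) * (x * R) + of_real (l / 9)"
    proof -
      have R3: "R ^ 3 = x\<^sup>2 * (R\<^sup>2 - D / 3) - 2 * (of_nat m + 2) / 3 * x * R
          + (of_nat m + 1) * (of_nat m + 2) / 9 + R * D - E / 9"
        unfolding eq[symmetric] by simp
      show ?thesis
        unfolding R3 n[symmetric] k_def l_def by (simp add: field_simps)
    qed
    also have "norm \<dots> \<le> norm R * norm D + norm (x\<^sup>2) * norm D / 3 + norm E / 9 + 2 / 3 * \<bar>k\<bar> * (norm x * norm R) + \<bar>l\<bar> / 9"
    proof -
      have "norm (u - v - w + f + g) \<le> norm u + norm v + norm w + norm f + norm g" for u v w f g :: complex
        by (smt (verit) norm_triangle_ineq norm_triangle_ineq4)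
      from this[of "R * D" "x\<^sup>2 * D / 3" "E / 9" "of_real (2 / 3 * k) * (x * R)" "of_real (l / 9)"]
      show ?thesis
        by (simp add: norm_mult norm_divide norm_power abs_mult)
    qed
    also have "\<dots> \<le> c\<^sup>2 * B * (c * D0) + c\<^sup>2 * Y\<^sup>2 * (c * D0) / 3 + E0 / 9 + 4 / 3 * (c * Y * (c\<^sup>2 * B)) + 5 * real n / 9"
    proof -
      have "norm R * norm D \<le> c\<^sup>2 * B * (c * D0)"
        using R D pos c by (intro mult_mono) auto
      moreover have "norm (x\<^sup>2) * norm D \<le> c\<^sup>2 * Y\<^sup>2 * (c * D0)"
        using x2 D by (intro mult_mono) auto
      moreover have "norm x * norm R \<le> c * Y * (c\<^sup>2 * B)"
        using x R assms c by (intro mult_mono) auto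
      from mult_mono[OF k this] have "\<bar>k\<bar> * (norm x * norm R) \<le> 2 * (c * Y * (c\<^sup>2 * B))"
        by simp
      ultimately show ?thesis
        using E l by (simp add: mult.assoc)
    qed
    also have "\<dots> \<le> C * real n"
    proof -
      have "E0 \<le> E0 * real n" using pos n1 by (simp add: mult_le_cancel_left1)
      then show ?thesis unfolding C_def n by (simp add: algebra_simps power2_eq_square power3_eq_cube)
    qed
    finally have "(real n)\<^sup>2 * norm (spectral_cubic y Z) \<le> C * real n"
      unfolding n by (simp add: norm_mult norm_power)
    then have est2: "norm (spectral_cubic y Z) \<le> C / real n"
      using n1 by (simp add: field_simps power2_eq_square)
    show "norm (scaled_ratio n m y - y\<^sup>2) \<le> 2 / (3 * d) \<and>
        norm (spectral_cubic y (scaled_ratio n m y)) \<le> C / real n"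
      using est1 est2 Z by simp
  qed
qed

subsection \<open>Convergence to the simple root\<close>

lemma spectral_cubic_taylor:
  "spectral_cubic y z = spectral_cubic y w + (z - w) * (3 * w\<^sup>2 - 2 * y\<^sup>2 * w + 2 / 3 * y)
     + (3 * w - y\<^sup>2) * (z - w)\<^sup>2 + (z - w) ^ 3"
  unfolding spectral_cubic_def by algebra

text \<open>In the Taylor expansion at w the linear coefficient has modulus at least m; after
  division by z - w the remainder is at most (M + 1) \<delta> \<le> m/2, so the linear term
  dominates.\<close>

lemma approx_root_close:
  assumes root: "spectral_cubic y w = 0"
    and m: "m \<le> norm (3 * w\<^sup>2 - 2 * y\<^sup>2 * w + 2 / 3 * y)" and M: "norm (3 * w - y\<^sup>2) \<le> M"
    and close: "norm (z - w) \<le> \<delta>" and \<delta>: "\<delta> \<le> 1" "(M + 1) * \<delta> \<le> m / 2"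
  shows "m / 2 * norm (z - w) \<le> norm (spectral_cubic y z)"
proof -
  define h q where "h = z - w" and "q = 3 * w\<^sup>2 - 2 * y\<^sup>2 * w + 2 / 3 * y"
  define r where "r = (3 * w - y\<^sup>2) * h + h\<^sup>2"
  have "0 \<le> norm h" by simp
  have eq: "spectral_cubic y z = h * (q + r)"
    unfolding spectral_cubic_taylor[of y z w] root h_def q_def r_def by algebra
  have "norm r \<le> norm (3 * w - y\<^sup>2) * norm h + norm h * norm h"
    unfolding r_def by (rule order_trans[OF norm_triangle_ineq]) (simp add: norm_mult power2_eq_square)
  also have "\<dots> \<le> M * \<delta> + 1 * \<delta>"
    using M close \<delta> order_trans[OF norm_ge_zero M] unfolding h_def by (intro add_mono mult_mono) auto
  also have "\<dots> \<le> m / 2" using \<delta> by (simp add: algebra_simps)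
  finally have "m / 2 \<le> norm (q + r)"
    using m norm_diff_ineq[of q r] unfolding q_def by linarith
  then have "norm h * (m / 2) \<le> norm h * norm (q + r)"
    by (intro mult_left_mono) auto
  then show ?thesis unfolding eq norm_mult h_def by (simp add: mult.commute)
qed

text \<open>The difference quotient \<open>G\<close> of the cubic between two points near y^2 is y^4
  plus terms of modulus at most 4 r^2 + r + 3 with r = |y|, hence of modulus at least 1 once r \<ge>
  3.\<close>

lemma large_root_close:
  assumes root: "spectral_cubic y w = 0" and "norm (w - y\<^sup>2) \<le> 1" "norm (z - y\<^sup>2) \<le> 1" "norm y \<ge> 3"
  shows "norm (z - w) \<le> norm (spectral_cubic y z)"
proof -
  define a b r where "a = z - y\<^sup>2" and "b = w - y\<^sup>2" and "r = norm y"
  define G where "G = y ^ 4 + (2 * y\<^sup>2 * (a + b) + (a\<^sup>2 + a * b + b\<^sup>2) + 2 / 3 * y)"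
  have eq: "spectral_cubic y z = (z - w) * G"
  proof -
    have "spectral_cubic y z = spectral_cubic y z - spectral_cubic y w" using root by simp
    also have "\<dots> = (z - w) * G"
      unfolding spectral_cubic_def G_def a_def b_def by algebra
    finally show ?thesis .
  qed
  have ab: "norm a \<le> 1" "norm b \<le> 1" using assms by (auto simp: a_def b_def)
  have "norm (2 * y\<^sup>2 * (a + b)) \<le> 2 * r\<^sup>2 * 2"
    unfolding norm_mult r_def norm_power using ab norm_triangle_ineq[of a b]
    by (intro mult_mono) auto
  moreover have "norm (a\<^sup>2 + a * b + b\<^sup>2) \<le> 3"
  proof -
    have "norm (a\<^sup>2 + a * b + b\<^sup>2) \<le> norm a * norm a + norm a * norm b + norm b * norm b"
      by (smt (verit) norm_triangle_ineq norm_mult power2_eq_square)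
    also have "\<dots> \<le> 1 * 1 + 1 * 1 + 1 * 1"
      using ab by (intro add_mono mult_mono) auto
    finally show ?thesis by simp
  qed
  moreover have "norm (2 / 3 * y) \<le> r" by (simp add: r_def norm_mult)
  ultimately have "norm (2 * y\<^sup>2 * (a + b) + (a\<^sup>2 + a * b + b\<^sup>2) + 2 / 3 * y) \<le> 2 * r\<^sup>2 * 2 + 3 + r"
    by (intro norm_triangle_mono)
  then have "norm G \<ge> r ^ 4 - (2 * r\<^sup>2 * 2 + 3 + r)"
    unfolding G_def using norm_diff_ineq[of "y ^ 4" "2 * y\<^sup>2 * (a + b) + (a\<^sup>2 + a * b + b\<^sup>2) + 2 / 3 * y"]
    by (simp add: r_def norm_power)
  moreover have "r ^ 4 - (2 * r\<^sup>2 * 2 + 3 + r) \<ge> 1"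
  proof -
    have r: "r \<ge> 3" using assms by (simp add: r_def)
    then have "r\<^sup>2 \<ge> 3 * r" by (simp add: power2_eq_square)
    moreover have "r\<^sup>2 * 9 \<le> r\<^sup>2 * r\<^sup>2"
      using r power_mono[of 3 r 2] by (intro mult_left_mono) auto
    then have "9 * r\<^sup>2 \<le> r ^ 4" by (simp add: power4_eq_xxxx power2_eq_square mult.assoc mult.commute)
    ultimately show ?thesis using r by linarith
  qed
  ultimately have "norm G \<ge> 1" by simp
  then have "norm (z - w) * 1 \<le> norm (z - w) * norm G"
    by (intro mult_left_mono) auto
  then show ?thesis unfolding eq norm_mult by simp
qed

lemma closed_Compl_star_compl: "closed (- star_compl)"
proof -
  have "- star_compl = (\<lambda>x. x ^ 3) -` \<real>\<^sub>\<ge>\<^sub>0"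
    by (auto simp: star_compl_iff)
  then show ?thesis
    by (auto intro!: closed_vimage continuous_intros closed_nonneg_Reals_complex)
qed

text \<open>Moving outwards along the rays \<open>{t * z | t \<ge> 1}\<close>, which stay in \<open>star_compl\<close>, connects each
  point of \<open>K\<close> with the region where the only root of the cubic near \<open>y\<^sup>2\<close> is \<open>\<Phi> y\<close>. Since
  \<open>\<Phi>\<close> is a simple root along the way, the approximate root \<open>Z n\<close> cannot leave its vicinity.\<close>

lemma uniform_limit_spectral_root:
  fixes Z :: "nat \<Rightarrow> complex \<Rightarrow> complex"
  assumes K: "compact K" "K \<subseteq> star_compl"
    and cont_Z: "\<And>n. n \<ge> 1 \<Longrightarrow> continuous_on star_compl (Z n)"
    and Z: "\<And>d Y. d > 0 \<Longrightarrow> Y \<ge> 0 \<Longrightarrow> \<exists>C\<ge>0. \<forall>n\<ge>1. \<forall>y. norm y \<le> Y \<longrightarrow>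
        (\<forall>a. a \<notin> star_compl \<longrightarrow> d \<le> norm (y - a)) \<longrightarrow>
        norm (Z n y - y\<^sup>2) \<le> 2 / (3 * d) \<and> norm (spectral_cubic y (Z n y)) \<le> C / real n"
    and cont: "continuous_on star_compl \<Phi>"
    and root: "\<And>y. y \<in> star_compl \<Longrightarrow> spectral_cubic y (\<Phi> y) = 0"
    and simple: "\<And>y. y \<in> star_compl \<Longrightarrow> 3 * (\<Phi> y)\<^sup>2 - 2 * y\<^sup>2 * \<Phi> y + 2 / 3 * y \<noteq> 0"
    and inf: "\<And>y. y \<in> star_compl \<Longrightarrow> norm y \<ge> b \<Longrightarrow> norm (\<Phi> y - y\<^sup>2) \<le> L / norm y"
  shows "uniform_limit K Z \<Phi> sequentially"
proof (cases "K = {}")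
  case True
  then show ?thesis by simp
next
  case False
  have zero: "0 \<notin> star_compl" by (simp add: star_compl_iff)
  obtain d where d: "d > 0" "\<And>x a. x \<in> K \<Longrightarrow> a \<notin> star_compl \<Longrightarrow> d \<le> dist x a"
  proof -
    have "\<exists>d>0. \<forall>x\<in>K. \<forall>a\<in>- star_compl. d \<le> dist x a"
      using K(2) by (intro separate_compact_closed K(1) closed_Compl_star_compl) auto
    then show thesis using that by blast
  qed
  \<comment> \<open>Distances to the rays grow by the factor T, and so |T z| \<ge> T d, as 0 lies on
    the rays. The entries of the maximum make T d large enough for the a priori bound on
    \<open>Z\<close>, for \<open>large_root_close\<close>, and for the asymptotics of \<Phi> to give
    an error of at most 1.\<close>
  define T where "T = Max {1, 1 / d, 3 / d, b / d, L / d}"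
  have T: "T \<ge> 1" "T \<ge> 1 / d" "T \<ge> 3 / d" "T \<ge> b / d" "T \<ge> L / d"
    unfolding T_def by (auto intro: Max_ge)
  then have Td: "T * d \<ge> 1" "T * d \<ge> 3" "T * d \<ge> b" "T * d \<ge> L"
    using d(1) by (simp_all add: field_simps)
  \<comment> \<open>The compact set swept out by K along the radial segments, on which all constants
    below are uniform.\<close>
  define K' where "K' = (\<lambda>(t, z). of_real t * z) ` ({1..T} \<times> K)"
  have "compact K'" unfolding K'_def
    by (intro compact_continuous_image compact_Times K compact_Icc)
       (auto intro!: continuous_intros simp: case_prod_unfold)
  have K'_sub: "K' \<subseteq> star_compl"
    using K(2) star_compl_scale by (force simp: K'_def)
  have in_K': "of_real t * z \<in> K'" if "t \<in> {1..T}" "z \<in> K" for t z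
    using that by (auto simp: K'_def)
  have dist_ray: "t * d \<le> norm (of_real t * z - a)" if "t \<ge> 1" "z \<in> K" "a \<notin> star_compl" for t z a
  proof -
    have "of_real (1 / t) * a \<notin> star_compl"
      using star_compl_scale[of "1 / t" a] that by simp
    then have "t * d \<le> t * norm (z - of_real (1 / t) * a)"
      using d(2)[OF that(2)] that(1) by (simp add: dist_norm)
    also have "\<dots> = norm (of_real t * (z - of_real (1 / t) * a))"
      using that(1) by (simp add: norm_mult)
    also have "of_real t * (z - of_real (1 / t) * a) = of_real t * z - a"
      using that(1) by (simp add: algebra_simps)
    finally show ?thesis .
  qed
  have dist_K': "d \<le> norm (y - a)" if "y \<in> K'" "a \<notin> star_compl" for y a
  proof -
    obtain t z where tz: "t \<ge> 1" "z \<in> K" "y = of_real t * z"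
      using \<open>y \<in> K'\<close> by (auto simp: K'_def)
    have "1 * d \<le> t * d" using tz d(1) by (intro mult_right_mono) auto
    then show ?thesis using dist_ray[OF tz(1,2) that(2)] tz(3) by simp
  qed
  obtain Y where Y: "Y > 0" "\<And>y. y \<in> K' \<Longrightarrow> norm y \<le> Y"
    using compact_imp_bounded[OF \<open>compact K'\<close>] by (auto simp: bounded_pos)
  have cont': "continuous_on K' \<Phi>" using cont K'_sub by (rule continuous_on_subset)
  obtain m where m: "m > 0" "\<And>y. y \<in> K' \<Longrightarrow> m \<le> norm (3 * (\<Phi> y)\<^sup>2 - 2 * y\<^sup>2 * \<Phi> y + 2 / 3 * y)"
  proof -
    define f where "f = (\<lambda>y. norm (3 * (\<Phi> y)\<^sup>2 - 2 * y\<^sup>2 * \<Phi> y + 2 / 3 * y))"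
    have "continuous_on K' f" unfolding f_def by (intro continuous_intros cont')
    moreover have "K' \<noteq> {}" using in_K'[of 1] T(1) False by auto
    ultimately obtain y0 where "y0 \<in> K'" "\<And>y. y \<in> K' \<Longrightarrow> f y0 \<le> f y"
      using continuous_attains_inf[OF \<open>compact K'\<close>] by blast
    moreover have "f y0 > 0" using simple K'_sub \<open>y0 \<in> K'\<close> by (auto simp: f_def)
    ultimately show thesis using that unfolding f_def by blast
  qed
  obtain M where M: "M > 0" "\<And>y. y \<in> K' \<Longrightarrow> norm (3 * \<Phi> y - y\<^sup>2) \<le> M"
  proof -
    have "compact ((\<lambda>y. 3 * \<Phi> y - y\<^sup>2) ` K')"
      by (intro compact_continuous_image continuous_intros cont' \<open>compact K'\<close>)
    from compact_imp_bounded[OF this] show thesis using that by (auto simp: bounded_pos)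
  qed
  define \<delta> where "\<delta> = min 1 (m / (2 * (M + 1)))"
  have \<delta>: "\<delta> > 0" "\<delta> \<le> 1" "(M + 1) * \<delta> \<le> m / 2"
  proof -
    show "\<delta> > 0" "\<delta> \<le> 1" using m(1) M(1) by (auto simp: \<delta>_def)
    have "(M + 1) * \<delta> \<le> (M + 1) * (m / (2 * (M + 1)))"
      using M(1) by (intro mult_left_mono) (auto simp: \<delta>_def)
    also have "\<dots> = m / 2"
    proof -
      have "M + 1 \<noteq> 0" using M(1) by simp
      then show ?thesis by (metis mult.commute nonzero_mult_divide_mult_cancel_left times_divide_eq_right)
    qed
    finally show "(M + 1) * \<delta> \<le> m / 2" .
  qed
  obtain C where C: "C \<ge> 0" "\<And>n y. n \<ge> 1 \<Longrightarrow> y \<in> K' \<Longrightarrow> norm (spectral_cubic y (Z n y)) \<le> C / real n"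
    using Z[OF d(1), of Y] Y dist_K' by (metis less_imp_le)
  show ?thesis
  proof (rule uniform_limitI)
    fix e :: real assume "e > 0"
    \<comment> \<open>The three bounds serve, in this order, the outer end of the segment, the gap
      along it, and the final accuracy e.\<close>
    define \<eta> where "\<eta> = min (\<delta> / 2) (min (m / 2 * (\<delta> / 2)) (m / 2 * e))"
    have "\<eta> > 0" using \<open>e > 0\<close> \<delta>(1) m(1) by (simp add: \<eta>_def)
    have "(\<lambda>n. C / real n) \<longlonglongrightarrow> 0" by (rule lim_const_over_n)
    then have "eventually (\<lambda>n. C / real n < \<eta>) sequentially"
      using \<open>\<eta> > 0\<close> by (rule order_tendstoD)
    then show "\<forall>\<^sub>F n in sequentially. \<forall>z\<in>K. dist (Z n z) (\<Phi> z) < e"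
      using eventually_ge_at_top[of 1]
    proof eventually_elim
      case (elim n)
      show ?case
      proof
        fix z assume z: "z \<in> K"
        define h where "h = (\<lambda>t. norm (Z n (of_real t * z) - \<Phi> (of_real t * z)))"
        have cubic: "norm (spectral_cubic y (Z n y)) < \<eta>" if "y \<in> K'" for y
          using C(2)[OF elim(2) that] elim(1) by linarith
        have gap: "m / 2 * h t < \<eta>" if "t \<in> {1..T}" "h t \<le> \<delta>" for t
        proof -
          have y: "of_real t * z \<in> K'" using in_K' that z by blast
          then have "m / 2 * h t \<le> norm (spectral_cubic (of_real t * z) (Z n (of_real t * z)))"
            unfolding h_def using that(2) K'_sub
            by (intro approx_root_close[OF root m(2)[OF y] M(2)[OF y] _ \<delta>(2,3)]) (auto simp: h_def)
          then show ?thesis using cubic[OF y] by linarith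
        qed
        \<comment> \<open>A distance of at most \<delta> is already below \<delta>/2, so h takes no
          value between \<delta>/2 and \<delta>.\<close>
        have gap': "h t < \<delta> / 2" if "t \<in> {1..T}" "h t \<le> \<delta>" for t
        proof -
          have "m / 2 * h t < m / 2 * (\<delta> / 2)" using gap[OF that] by (simp add: \<eta>_def)
          then show ?thesis using m(1) by (simp add: mult_less_cancel_left_pos)
        qed
        have "h T < \<delta> / 2"
        proof -
          define y where "y = of_real T * z"
          have y: "y \<in> K'" using in_K' T(1) z by (simp add: y_def)
          have "T * d \<le> norm y" using dist_ray[OF T(1) z zero] by (simp add: y_def)
          then have ny: "norm y \<ge> 3" "norm y \<ge> b" "norm y \<ge> L" using Td by auto
          have "norm (\<Phi> y - y\<^sup>2) \<le> L / norm y" using inf K'_sub y ny by blast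
          also have "L / norm y \<le> 1" using ny by (auto simp: divide_simps)
          finally have 1: "norm (\<Phi> y - y\<^sup>2) \<le> 1" .
          have "norm (Z n y - y\<^sup>2) \<le> 2 / (3 * (T * d))"
            using Z[of "T * d" "norm y"] Td(1) elim(2) dist_ray[OF T(1) z]
            unfolding y_def by auto
          also have "\<dots> \<le> 1" using Td(1) by (simp add: divide_simps)
          finally have "norm (Z n y - \<Phi> y) \<le> norm (spectral_cubic y (Z n y))"
            using large_root_close[OF root 1] K'_sub y ny by blast
          also have "\<dots> < \<eta>" by (rule cubic[OF y])
          finally show ?thesis by (simp add: h_def y_def \<eta>_def)
        qed
        \<comment> \<open>Otherwise h, which is below \<delta>/2 at T, would take the value \<delta>
          in between.\<close>
        have "h 1 \<le> \<delta>"
        proof (rule ccontr)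
          assume "\<not> h 1 \<le> \<delta>"
          moreover have "continuous_on {1..T} h"
            unfolding h_def using K'_sub in_K' z
            by (intro continuous_intros continuous_on_compose2[OF cont_Z[OF elim(2)]]
                continuous_on_compose2[OF cont]) auto
          ultimately obtain t where "t \<in> {1..T}" "h t = \<delta>"
            using IVT2'[of h T \<delta> 1] \<open>h T < \<delta> / 2\<close> T(1) \<delta>(1) by auto
          with gap'[of t] \<delta>(1) show False by auto
        qed
        then have "m / 2 * h 1 < m / 2 * e"
          using gap[of 1] T(1) by (simp add: \<eta>_def)
        then show "dist (Z n z) (\<Phi> z) < e"
          using m(1) by (simp add: h_def dist_norm mult_less_cancel_left_pos)
      qed
    qed
  qed
qed

section \<open>The explicit root from Cardano's formula\<close>

text \<open>The summands of \<open>S\<close> have product x, and their cubes add up to -3, so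
  \<open>S\<close> is a Cardano root of the depressed cubic; its square is the denominator in
  \<open>Phi_of\<close>.\<close>

lemma Phi_of_cardano:
  assumes "cardano_branches R A B" "x \<in> star_compl"
  defines "S \<equiv> omega\<^sup>2 * A x + omega * B x"
  shows "S \<noteq> 0" "S ^ 3 = 3 * x * S - 3" "Phi_of A B x = 1 / S\<^sup>2"
proof -
  have AB: "A x ^ 3 = (- 3 + R x) / 2" "B x ^ 3 = (- 3 - R x) / 2" "A x * B x = x"
    using assms by (auto simp: cardano_branches_def)
  have sum: "A x ^ 3 + B x ^ 3 = - 3" unfolding AB(1,2) by (simp add: field_simps)
  have "(w\<^sup>2 * a + w * b) ^ 3 =
      w ^ 3 * (w ^ 3 * a ^ 3 + 3 * (a * b) * (w\<^sup>2 * a + w * b) + b ^ 3)" for w a b :: complex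
    by algebra
  from this[of omega "A x" "B x"] show S: "S ^ 3 = 3 * x * S - 3"
    using sum unfolding omega_cube AB(3) S_def[symmetric] by (simp add: algebra_simps)
  then show "S \<noteq> 0" by auto
  have "omega * omega\<^sup>2 = 1"
    using omega_cube by (simp add: power2_eq_square power3_eq_cube mult.assoc)
  then have "inverse omega = omega\<^sup>2"
    by (rule inverse_unique)
  then have "exp (- (2 * of_real pi * \<i> / 3)) = omega\<^sup>2"
    by (simp add: omega_def exp_minus)
  then have Phi: "Phi_of A B x = 1 / (omega * A x ^ 2 + omega\<^sup>2 * B x ^ 2 + 2 * x)"
    by (simp add: Phi_of_def flip: omega_def)
  have "(w\<^sup>2 * a + w * b)\<^sup>2 = w ^ 3 * (w * a\<^sup>2 + 2 * (a * b)) + w\<^sup>2 * b\<^sup>2" for w a b :: complex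
    by algebra
  from this[of omega "A x" "B x"] have "S\<^sup>2 = omega * A x ^ 2 + omega\<^sup>2 * B x ^ 2 + 2 * x"
    unfolding omega_cube AB(3) S_def by simp
  then show "Phi_of A B x = 1 / S\<^sup>2" by (simp add: Phi)
qed

text \<open>With \<open>\<Phi> = 1 / S\<^sup>2\<close>, the derivative of the cubic at its root \<open>\<Phi>\<close> is
  \<open>(3 - 2 * S ^ 3) / (3 * S ^ 4)\<close>, which vanishes only if \<open>x ^ 3 = 9 / 4\<close>.\<close>

lemma Phi_of_simple_root:
  assumes "cardano_branches R A B" "x \<in> star_compl"
  shows "spectral_cubic x (Phi_of A B x) = 0"
    and "3 * (Phi_of A B x)\<^sup>2 - 2 * x\<^sup>2 * Phi_of A B x + 2 / 3 * x \<noteq> 0"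
proof -
  obtain S where S: "S \<noteq> 0" "S ^ 3 = 3 * x * S - 3" "Phi_of A B x = 1 / S\<^sup>2"
    using Phi_of_cardano[OF assms] by blast
  define T where "T = 1 / S"
  have T: "S * T = 1" and Phi: "Phi_of A B x = T\<^sup>2"
    using S by (auto simp: T_def power_one_over)
  \<comment> \<open>The cubic for \<open>S\<close> gives x - S^2/3 = 1/S = \<open>T\<close>;
    squaring this is the equation for \<Phi> = T^2.\<close>
  have "9 * spectral_cubic x (T\<^sup>2) = 0"
    using T S(2) unfolding spectral_cubic_def by simp algebra
  then show "spectral_cubic x (Phi_of A B x) = 0" by (simp add: Phi)
  show "3 * (Phi_of A B x)\<^sup>2 - 2 * x\<^sup>2 * Phi_of A B x + 2 / 3 * x \<noteq> 0"
  proof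
    assume "3 * (Phi_of A B x)\<^sup>2 - 2 * x\<^sup>2 * Phi_of A B x + 2 / 3 * x = 0"
    then have "9 * (T\<^sup>2)\<^sup>2 - 6 * x\<^sup>2 * T\<^sup>2 + 2 * x = 0"
      unfolding Phi by (simp add: field_simps)
    then have "2 * S ^ 3 = 3"
      using T S(2) by algebra
    have "3 * (2 * x * S) = 3 * 3"
      using S(2) \<open>2 * S ^ 3 = 3\<close> by algebra
    then have "2 * x * S = 3" by (simp add: mult_ac)
    have "2 * x = 2 * x * S * T" using T by (simp add: mult.assoc)
    then have "2 * x = 3 * T" unfolding \<open>2 * x * S = 3\<close> .
    have "3 * T ^ 3 = 2 * (S * T) ^ 3"
      by (simp add: power_mult_distrib flip: \<open>2 * S ^ 3 = 3\<close>)
    then have "3 * T ^ 3 = 2" unfolding T by simp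
    with \<open>2 * x = 3 * T\<close> have "4 * x ^ 3 = 9"
      by algebra
    then have "x ^ 3 = of_real (9 / 4)" by (simp add: field_simps)
    moreover have "complex_of_real (9 / 4) \<in> \<real>\<^sub>\<ge>\<^sub>0" by (subst nonneg_Reals_of_real_iff) simp
    ultimately have "x ^ 3 \<in> \<real>\<^sub>\<ge>\<^sub>0" by (simp only:)
    with assms(2) show False by (simp add: star_compl_iff)
  qed
qed

lemma continuous_on_Phi_of:
  assumes "cardano_branches R A B"
  shows "continuous_on star_compl (Phi_of A B)"
proof -
  have "continuous_on star_compl A" "continuous_on star_compl B"
    using assms by (auto simp: cardano_branches_def intro: holomorphic_on_imp_continuous_on analytic_imp_holomorphic)
  then have "continuous_on star_compl (\<lambda>x. 1 / (omega\<^sup>2 * A x + omega * B x)\<^sup>2)"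
    using Phi_of_cardano(1)[OF assms] by (intro continuous_intros) auto
  then show ?thesis
    using Phi_of_cardano(3)[OF assms] by (simp cong: continuous_on_cong)
qed

section \<open>Uniform limits of the rescaled ratios\<close>

lemma raise_iterate_scaled_nonzero:
  assumes "x \<in> star_compl" "n \<ge> 1"
  shows "poly ((raise ^^ m) 1) (of_real (real n powr (1/3)) * x) \<noteq> 0"
proof
  assume "poly ((raise ^^ m) 1) (of_real (real n powr (1/3)) * x) = 0"
  then have "of_real (real n powr (1/3)) * x \<notin> star_compl"
    by (rule raise_iterate_root_notin_star_compl)
  then show False
    using star_compl_scale[of "real n powr (1/3)" x] assms by simp
qed

text \<open>The bounds on m allow the indices n - 1 and n, so both limits of the theorem come from
  this one statement.\<close>

lemma uniform_limit_scaled_ratio: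
  fixes m :: "nat \<Rightarrow> nat"
  assumes branches: "cardano_branches R A B"
    and inf: "\<And>y. y \<in> star_compl \<Longrightarrow> norm y \<ge> b \<Longrightarrow> norm (Phi_of A B y - y\<^sup>2) \<le> L / norm y"
    and K: "compact K" "K \<subseteq> star_compl"
    and m: "\<And>n. m n \<le> n" "\<And>n. n \<le> m n + 1"
  shows "uniform_limit K (\<lambda>n. scaled_ratio n (m n)) (Phi_of A B) sequentially"
proof (rule uniform_limit_spectral_root[OF K])
  fix n :: nat assume n: "n \<ge> 1"
  then show "continuous_on star_compl (scaled_ratio n (m n))"
    unfolding scaled_ratio_def Let_def
    by (intro continuous_intros ballI raise_iterate_scaled_nonzero) simp_all
next
  fix d Y :: real assume "d > 0" "Y \<ge> 0"
  from scaled_ratio_estimate[OF this]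
  show "\<exists>C\<ge>0. \<forall>n\<ge>1. \<forall>y. norm y \<le> Y \<longrightarrow> (\<forall>a. a \<notin> star_compl \<longrightarrow> d \<le> norm (y - a)) \<longrightarrow>
      norm (scaled_ratio n (m n) y - y\<^sup>2) \<le> 2 / (3 * d) \<and>
      norm (spectral_cubic y (scaled_ratio n (m n) y)) \<le> C / real n"
    using m by meson
next
  show "norm (Phi_of A B y - y\<^sup>2) \<le> L / norm y" if "y \<in> star_compl" "norm y \<ge> b" for y
    using inf that .
qed (use Phi_of_simple_root[OF branches] continuous_on_Phi_of[OF branches] in blast)+

theorem theorem4p2:
  fixes P :: "nat \<Rightarrow> complex poly"
    and R A B \<Phi> :: "complex \<Rightarrow> complex"
    and K :: "complex set"
  assumes P: "\<And>n. is_diag_MOP n (P n)"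
    and branches: "cardano_branches R A B"
    and Phi: "\<And>x. x \<in> star_compl \<Longrightarrow> \<Phi> x = Phi_of A B x"
    and Phi_at_infinity:
      "(\<lambda>x. \<Phi> x - x ^ 2) \<in> O[inf at_infinity (principal star_compl)](\<lambda>x. 1 / x)"
    and K: "compact K" "K \<subseteq> star_compl"
  shows "uniform_limit K
      (\<lambda>n x. 1 / of_real (real n powr (2/3)) *
         (poly (P n) (of_real (real n powr (1/3)) * x) /
          poly (P (n - 1)) (of_real (real n powr (1/3)) * x)))
      \<Phi> sequentially \<and>
    uniform_limit K
      (\<lambda>n x. 1 / of_real (real n powr (2/3)) *
         (poly (pderiv (P n)) (of_real (real n powr (1/3)) * x) /
          poly (P n) (of_real (real n powr (1/3)) * x)))
      (\<lambda>x. 3 * x ^ 2 - 3 * \<Phi> x) sequentially"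
proof -
  have P_eq: "P n = (raise ^^ n) 1" for n
    using P by (rule is_diag_MOP_unique)
  have powr: "of_real (real n powr (2/3)) = (of_real (real n powr (1/3)) ^ 2 :: complex)" for n
    by (cases "n = 0") (simp_all add: powr_power flip: of_real_power)
  obtain L where "\<forall>\<^sub>F x in inf at_infinity (principal star_compl). norm (\<Phi> x - x\<^sup>2) \<le> L * norm (1 / x)"
    using Phi_at_infinity by (elim landau_o.bigE)
  then obtain b where "\<And>x. norm x \<ge> b \<Longrightarrow> x \<in> star_compl \<Longrightarrow> norm (\<Phi> x - x\<^sup>2) \<le> L * norm (1 / x)"
    unfolding eventually_inf_principal eventually_at_infinity by blast
  then have inf: "norm (Phi_of A B x - x\<^sup>2) \<le> L / norm x" if "x \<in> star_compl" "norm x \<ge> b" for x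
    using that Phi by (auto simp: norm_divide)
  note ratio = uniform_limit_scaled_ratio[OF branches inf K]
  \<comment> \<open>The expressions are matched only for n \<ge> 1, where
    \<open>Suc (n - 1) = n\<close> and the scale is nonzero; this suffices for the limit.\<close>
  have cong: "uniform_limit K f g sequentially"
    if "uniform_limit K f' g' sequentially" "\<And>n x. n \<ge> 1 \<Longrightarrow> x \<in> K \<Longrightarrow> f' n x = f n x"
      "\<And>x. x \<in> K \<Longrightarrow> g' x = g x" for f f' :: "nat \<Rightarrow> complex \<Rightarrow> complex" and g g'
  proof -
    have ev: "\<forall>\<^sub>F n in sequentially. \<forall>x\<in>K. f' n x = f n x"
      by (rule eventually_mono[OF eventually_ge_at_top[of 1]]) (use that(2) in blast)
    have "uniform_limit K f' g' sequentially \<longleftrightarrow> uniform_limit K f g sequentially"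
      by (rule uniform_limit_cong[OF ev that(3)])
    with that(1) show ?thesis by blast
  qed
  have 1: "uniform_limit K
      (\<lambda>n x. 1 / of_real (real n powr (2/3)) *
         (poly (P n) (of_real (real n powr (1/3)) * x) /
          poly (P (n - 1)) (of_real (real n powr (1/3)) * x)))
      \<Phi> sequentially"
  proof (rule cong)
    show "uniform_limit K (\<lambda>n. scaled_ratio n (n - 1)) (Phi_of A B) sequentially"
      by (rule ratio) auto
    fix n :: nat and x assume "n \<ge> 1"
    then have "Suc (n - 1) = n" by simp
    then show "scaled_ratio n (n - 1) x = 1 / of_real (real n powr (2/3)) *
         (poly (P n) (of_real (real n powr (1/3)) * x) / poly (P (n - 1)) (of_real (real n powr (1/3)) * x))"
      by (simp only: scaled_ratio_def Let_def P_eq powr) simp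
  qed (use Phi K(2) in auto)
  have 2: "uniform_limit K
      (\<lambda>n x. 1 / of_real (real n powr (2/3)) *
         (poly (pderiv (P n)) (of_real (real n powr (1/3)) * x) /
          poly (P n) (of_real (real n powr (1/3)) * x)))
      (\<lambda>x. 3 * x ^ 2 - 3 * \<Phi> x) sequentially"
  proof (rule cong)
    have "uniform_limit K (\<lambda>n. scaled_ratio n n) (Phi_of A B) sequentially"
      by (rule ratio) auto
    then show "uniform_limit K (\<lambda>n x. 3 * x\<^sup>2 - 3 * scaled_ratio n n x) (\<lambda>x. 3 * x\<^sup>2 - 3 * Phi_of A B x) sequentially"
    proof -
      assume "uniform_limit K (\<lambda>n. scaled_ratio n n) (Phi_of A B) sequentially"
      then have "uniform_limit K (\<lambda>n x. 3 * scaled_ratio n n x) (\<lambda>x. 3 * Phi_of A B x) sequentially"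
        by (rule bounded_linear.uniform_limit[OF bounded_linear_mult_right])
      then show ?thesis by (intro uniform_limit_minus uniform_limit_const)
    qed
    fix n :: nat and x assume nx: "n \<ge> 1" "x \<in> K"
    define c where "c = complex_of_real (real n powr (1/3))"
    have c: "c \<noteq> 0" using nx by (simp add: c_def)
    have nz: "poly (P n) (c * x) \<noteq> 0"
      unfolding P_eq c_def using nx K(2) by (intro raise_iterate_scaled_nonzero) auto
    have "poly (pderiv (P n)) (c * x) = 3 * (c * x)\<^sup>2 * poly (P n) (c * x) - 3 * poly (P (Suc n)) (c * x)"
      by (simp add: P_eq poly_raise)
    then show "3 * x\<^sup>2 - 3 * scaled_ratio n n x = 1 / of_real (real n powr (2/3)) *
         (poly (pderiv (P n)) (of_real (real n powr (1/3)) * x) /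
          poly (P n) (of_real (real n powr (1/3)) * x))"
      unfolding scaled_ratio_def Let_def P_eq[symmetric] powr c_def[symmetric] using nz c
      by (simp add: field_simps power_mult_distrib)
  qed (use Phi K(2) in auto)
  from 1 2 show ?thesis by blast
qed

end
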